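(* Let $D$ be any Dedekind domain and $\mathfrak{q}$ a non-zero ideal of $D$. Let $H$ be a subgroup of $G=SL_2(D)$ with level $l(H)=\mathfrak{q}$ and quasi-level $ql(H)$. If $H$ is a congruence subgroup, then the following hold: a) $G(\mathfrak{q})\subseteq H$. b) The ideal-theoretic sum of all cusp amplitudes of $H$ is again a cusp amplitude of $H$. c) The intersection of all cusp amplitudes of $H$ is again a cusp amplitude of $H$. d) The level $\mathfrak{q}$ of $H$ is a cusp amplitude of $H$. e) For any $\alpha\in D$ that is invertible modulo $\mathfrak{q}$ we have $\alpha^2\, ql(H)\subseteq ql(H)$. If $H$ is a congruence subgroup and moreover the level $\mathfrak{q}$ of $H$ satisfies Condition L, then: f) $ql(H)=l(H)$. g) If $|G:H|$ is finite, then $|D/l(H)|$ divides $(|G:H|)!$. If $H$ is a congruence subgroup, the level $\mathfrak{q}$ of $H$ satisfies Condition L, and in addition $H$ is a normal subgroup of $G$, then: h) Every quasi-amplitude of $H$ is actually a cusp amplitude of $H$. i) If $|G:H|$ is finite, then $|D/l(H)|$ divides $|G:H|$.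
   Context: Dedekind domains are integrally closed Noetherian domains of Krull dimension one (so not fields). Let $G=SL_2(D)$; for $r\in D$ put $T(r)=\begin{pmatrix}1&r\\0&1\end{pmatrix}$; for an ideal $\mathfrak{q}$ put $G(\mathfrak{q})=SL_2(D,\mathfrak{q})=\{X\in SL_2(D): X\equiv I_2\pmod{\mathfrak{q}}\}$. A subgroup $H\le G$ is a congruence subgroup if $G(\mathfrak{q}')\le H$ for some non-zero ideal $\mathfrak{q}'$ of $D$. For $g\in G$ the quasi-amplitude is $\mathfrak{b}(H,g)=\{b\in D: gT(b)g^{-1}\in H\}$ (an additive subgroup of $D$), and the cusp amplitude $\mathfrak{c}(H,g)$ is the largest ideal of $D$ contained in $\mathfrak{b}(H,g)$. The cusp amplitudes of $H$ are the ideals $\mathfrak{c}(H,g)$, $g\in G$, and the quasi-amplitudes of $H$ are the sets $\mathfrak{b}(H,g)$, $g\in G$. The quasi-level is $ql(H)=\bigcap_{g\in G}\mathfrak{b}(H,g)$, i.e. the set of $r\in D$ such that $T(r)$ lies in every conjugate of $H$ in $G$. The level $l(H)$ is the largest ideal of $D$ contained in $ql(H)$. Condition L for a subgroup $H$ of non-zero level $\mathfrak{q}=l(H)$: (i) $\mathfrak{q}+(2)=D$; and (ii) there are no prime ideals $\mathfrak{p}$ of $D$ for which $|D/\mathfrak{p}|=3$ and $\mathrm{ord}_{\mathfrak{p}}(\mathfrak{q})=1$, where $\mathrm{ord}_{\mathfrak{p}}(\mathfrak{q})$ is the exponent of $\mathfrak{p}$ in the prime factorization of $\mathfrak{q}$.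 *)

theory Defs
  imports
    "HOL-Algebra.Algebraic_Closure_Type"
    "HOL-Algebra.Ideal_Product"
    "HOL-Algebra.Ring_Divisibility"
    "HOL-Analysis.Determinants"
    "HOL-Library.Extended_Nat"
begin

text \<open>
  The domain is a type of class \<open>idom\<close>. Its ideals, quotients and so on are those of
  HOL-Algebra, applied to the ring record of the type (whose carrier is \<open>UNIV\<close>).
\<close>

abbreviation \<D> :: "'a::comm_ring_1 ring" where
  "\<D> \<equiv> ring_of_type_algebra"

definition krull_dim :: "('a, 'b) ring_scheme \<Rightarrow> enat" where
  "krull_dim R = Sup {enat n |n. \<exists>P. (\<forall>i\<le>n. primeideal (P i) R) \<and> (\<forall>i<n. P i \<subset> P (Suc i))}"

definition integral_over_base :: "'a::idom fract \<Rightarrow> bool" where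
  "integral_over_base x \<longleftrightarrow>
     (\<exists>p::'a poly. Polynomial.lead_coeff p = 1 \<and> poly (map_poly to_fract p) x = 0)"

definition integrally_closed :: "'a::idom itself \<Rightarrow> bool" where
  "integrally_closed _ \<longleftrightarrow> (\<forall>x::'a fract. integral_over_base x \<longrightarrow> x \<in> range to_fract)"

definition dedekind_domain :: "'a::idom itself \<Rightarrow> bool" where
  "dedekind_domain T \<longleftrightarrow>
     noetherian_domain (\<D> :: 'a ring) \<and> integrally_closed T \<and> krull_dim (\<D> :: 'a ring) = 1"

text \<open>
  The list below is a factorization of \<open>\<qq>\<close> into prime ideals (the empty product is the whole
  ring). For a non-zero ideal of a Dedekind domain it is unique up to order, so the exponent
  is well defined; it is \<open>0\<close> for primes that do not occur.
\<close>

definition prime_ideal_ord :: "'a::comm_ring_1 set \<Rightarrow> 'a set \<Rightarrow> nat" where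
  "prime_ideal_ord \<pp> \<qq> =
     (THE n. \<exists>ps. (\<forall>P\<in>set ps. primeideal P \<D>) \<and>
                  foldr (ideal_prod \<D>) ps UNIV = \<qq> \<and> count_list ps \<pp> = n)"

text \<open>Well defined whenever the argument is an additive subgroup: see \<open>largest_ideal_in\<close> below.\<close>

definition largest_ideal_in :: "'a::comm_ring_1 set \<Rightarrow> 'a set" where
  "largest_ideal_in S = (GREATEST I. ideal I \<D> \<and> I \<subseteq> S)"

definition SL2 :: "('a::comm_ring_1 ^ 2 ^ 2) monoid" where
  "SL2 = \<lparr>carrier = {A. det A = 1}, monoid.mult = (**), one = mat 1\<rparr>"

definition T :: "'a::comm_ring_1 \<Rightarrow> 'a ^ 2 ^ 2" where
  "T r = vector [vector [1, r], vector [0, 1]]"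

definition principal_congruence_subgroup :: "'a::comm_ring_1 set \<Rightarrow> ('a ^ 2 ^ 2) set" where
  "principal_congruence_subgroup \<qq> =
     {A \<in> carrier SL2. \<forall>i j. A $ i $ j - mat 1 $ i $ j \<in> \<qq>}"

definition congruence_subgroup :: "('a::comm_ring_1 ^ 2 ^ 2) set \<Rightarrow> bool" where
  "congruence_subgroup H \<longleftrightarrow> subgroup H SL2 \<and>
     (\<exists>\<qq>. ideal \<qq> \<D> \<and> \<qq> \<noteq> {0} \<and> principal_congruence_subgroup \<qq> \<subseteq> H)"

definition quasi_amplitude :: "('a::comm_ring_1 ^ 2 ^ 2) set \<Rightarrow> 'a ^ 2 ^ 2 \<Rightarrow> 'a set" where
  "quasi_amplitude H g = {b. g \<otimes>\<^bsub>SL2\<^esub> T b \<otimes>\<^bsub>SL2\<^esub> inv\<^bsub>SL2\<^esub> g \<in> H}"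

definition cusp_amplitude :: "('a::comm_ring_1 ^ 2 ^ 2) set \<Rightarrow> 'a ^ 2 ^ 2 \<Rightarrow> 'a set" where
  "cusp_amplitude H g = largest_ideal_in (quasi_amplitude H g)"

definition quasi_amplitudes :: "('a::comm_ring_1 ^ 2 ^ 2) set \<Rightarrow> 'a set set" where
  "quasi_amplitudes H = quasi_amplitude H ` carrier SL2"

definition cusp_amplitudes :: "('a::comm_ring_1 ^ 2 ^ 2) set \<Rightarrow> 'a set set" where
  "cusp_amplitudes H = cusp_amplitude H ` carrier SL2"

definition quasi_level :: "('a::comm_ring_1 ^ 2 ^ 2) set \<Rightarrow> 'a set" where
  "quasi_level H = (\<Inter>g\<in>carrier SL2. quasi_amplitude H g)"

definition level :: "('a::comm_ring_1 ^ 2 ^ 2) set \<Rightarrow> 'a set" where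
  "level H = largest_ideal_in (quasi_level H)"

definition condition_L :: "'a::comm_ring_1 set \<Rightarrow> bool" where
  "condition_L \<qq> \<longleftrightarrow>
     \<qq> <+>\<^bsub>\<D>\<^esub> Idl\<^bsub>\<D>\<^esub> {2} = UNIV \<and>
     \<not> (\<exists>\<pp>. primeideal \<pp> \<D> \<and> card (carrier (\<D> Quot \<pp>)) = 3 \<and> prime_ideal_ord \<pp> \<qq> = 1)"

lemma carrier_ring_of_type [simp]: "carrier (\<D> :: 'a::comm_ring_1 ring) = UNIV"
  and zero_ring_of_type [simp]: "\<zero>\<^bsub>(\<D> :: 'a::comm_ring_1 ring)\<^esub> = 0"
  and one_ring_of_type [simp]: "\<one>\<^bsub>(\<D> :: 'a::comm_ring_1 ring)\<^esub> = 1"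
  and add_ring_of_type [simp]: "x \<oplus>\<^bsub>(\<D> :: 'a::comm_ring_1 ring)\<^esub> y = x + y"
  and mult_ring_of_type [simp]: "x \<otimes>\<^bsub>(\<D> :: 'a::comm_ring_1 ring)\<^esub> y = x * y"
  by (simp_all add: ring_of_type_algebra_def)

lemma group_SL2: "group (SL2 :: ('a::comm_ring_1 ^ 2 ^ 2) monoid)"
proof (rule groupI)
  fix A :: "'a ^ 2 ^ 2"
  assume "A \<in> carrier SL2"
  then have d: "A$1$1 * A$2$2 - A$1$2 * A$2$1 = 1"
    by (simp add: SL2_def det_2)
  define B :: "'a ^ 2 ^ 2" where
    "B = vector [vector [A$2$2, - A$1$2], vector [- A$2$1, A$1$1]]"
  have "det B = 1" "B ** A = mat 1"
    using d by (auto simp: B_def det_2 vec_eq_iff forall_2 matrix_matrix_mult_def sum_2 mat_def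
        algebra_simps)
  then show "\<exists>B\<in>carrier SL2. B \<otimes>\<^bsub>SL2\<^esub> A = \<one>\<^bsub>SL2\<^esub>"
    by (auto simp: SL2_def)
qed (auto simp: SL2_def det_mul matrix_mul_assoc)

lemma T_in_SL2: "T r \<in> carrier SL2"
  by (simp add: T_def SL2_def det_2)

lemma ideal_ring_of_type_iff:
  fixes I :: "'a::comm_ring_1 set"
  shows "ideal I \<D> \<longleftrightarrow> 0 \<in> I \<and> (\<forall>x\<in>I. \<forall>y\<in>I. x + y \<in> I) \<and> (\<forall>x\<in>I. \<forall>r. r * x \<in> I)"
proof
  assume "ideal I \<D>"
  then have "additive_subgroup I \<D>"
    by (rule ideal.axioms)
  note closed = additive_subgroup.zero_closed[OF this] additive_subgroup.a_closed[OF this]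
    ideal.I_l_closed[OF \<open>ideal I \<D>\<close>]
  show "0 \<in> I \<and> (\<forall>x\<in>I. \<forall>y\<in>I. x + y \<in> I) \<and> (\<forall>x\<in>I. \<forall>r. r * x \<in> I)"
    using closed by simp
next
  assume *: "0 \<in> I \<and> (\<forall>x\<in>I. \<forall>y\<in>I. x + y \<in> I) \<and> (\<forall>x\<in>I. \<forall>r. r * x \<in> I)"
  interpret R: cring "\<D> :: 'a ring"
    by (rule cring_from_type_algebra)
  have inv_eq: "inv\<^bsub>add_monoid \<D>\<^esub> x = - 1 * x" for x :: 'a
    using group.inv_equality[OF R.a_group, of "- 1 * x" x] by simp
  have "subgroup I (add_monoid \<D>)"
  proof (rule subgroup.intro)
    show "inv\<^bsub>add_monoid \<D>\<^esub> x \<in> I" if "x \<in> I" for x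
      unfolding inv_eq using * that by blast
  qed (use * in simp_all)
  then show "ideal I \<D>"
    by (intro idealI R.ring_axioms) (use * in \<open>simp_all add: mult.commute\<close>)
qed

lemma largest_ideal_in:
  fixes S :: "'a::comm_ring_1 set"
  assumes "0 \<in> S" "\<And>x y. x \<in> S \<Longrightarrow> y \<in> S \<Longrightarrow> x + y \<in> S"
  shows "ideal (largest_ideal_in S) \<D>" "largest_ideal_in S \<subseteq> S"
    "\<And>J. ideal J \<D> \<Longrightarrow> J \<subseteq> S \<Longrightarrow> J \<subseteq> largest_ideal_in S"
proof -
  define M where "M = {x. \<forall>r. r * x \<in> S}"
  have M: "ideal M \<D>" "M \<subseteq> S"
    using assms by (auto simp: M_def ideal_ring_of_type_iff distrib_left mult.assoc[symmetric]
        dest: spec[of _ 1])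
  moreover have max: "J \<subseteq> M" if "ideal J \<D>" "J \<subseteq> S" for J
    using that by (auto simp: M_def ideal_ring_of_type_iff)
  ultimately have "largest_ideal_in S = M"
    unfolding largest_ideal_in_def by (intro Greatest_equality) auto
  with M max show "ideal (largest_ideal_in S) \<D>" "largest_ideal_in S \<subseteq> S"
    "\<And>J. ideal J \<D> \<Longrightarrow> J \<subseteq> S \<Longrightarrow> J \<subseteq> largest_ideal_in S"
    by auto
qed

lemma T_0: "T 0 = mat 1"
  by (simp add: T_def vec_eq_iff forall_2 mat_def)

lemma T_add: "T (a + b) = T a ** T b"
  by (simp add: T_def vec_eq_iff forall_2 matrix_matrix_mult_def sum_2 add.commute)

lemma quasi_amplitude_additive:
  fixes H :: "('a::comm_ring_1 ^ 2 ^ 2) set"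
  assumes H: "subgroup H SL2" and g: "g \<in> carrier SL2"
  shows "0 \<in> quasi_amplitude H g"
    and "\<And>x y. x \<in> quasi_amplitude H g \<Longrightarrow> y \<in> quasi_amplitude H g \<Longrightarrow> x + y \<in> quasi_amplitude H g"
proof -
  interpret group "SL2 :: ('a ^ 2 ^ 2) monoid"
    by (rule group_SL2)
  have 0: "T 0 = (\<one>\<^bsub>SL2\<^esub> :: 'a ^ 2 ^ 2)"
    by (simp add: T_0 SL2_def)
  show "0 \<in> quasi_amplitude H g"
    using g subgroup.one_closed[OF H] by (simp add: quasi_amplitude_def 0)
  fix x y
  assume xy: "x \<in> quasi_amplitude H g" "y \<in> quasi_amplitude H g"
  have "T (x + y) = T x \<otimes>\<^bsub>SL2\<^esub> T y"
    by (simp add: T_add SL2_def)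
  then have "g \<otimes>\<^bsub>SL2\<^esub> T (x + y) \<otimes>\<^bsub>SL2\<^esub> inv\<^bsub>SL2\<^esub> g =
      (g \<otimes>\<^bsub>SL2\<^esub> T x \<otimes>\<^bsub>SL2\<^esub> inv\<^bsub>SL2\<^esub> g) \<otimes>\<^bsub>SL2\<^esub> (g \<otimes>\<^bsub>SL2\<^esub> T y \<otimes>\<^bsub>SL2\<^esub> inv\<^bsub>SL2\<^esub> g)"
    using g T_in_SL2[of x] T_in_SL2[of y]
    by (simp add: m_assoc inv_solve_left)
  then show "x + y \<in> quasi_amplitude H g"
    using xy subgroup.m_closed[OF H] by (simp add: quasi_amplitude_def)
qed

end

theory Submission
  imports Defs "HOL-Library.Multiset" "HOL-Algebra.Bij"
begin

text \<open>
  Let \<open>N\<close> be the normal core of \<open>H\<close>; then \<open>r\<close> lies in the quasi-level iff \<open>T r \<in> N\<close>. If \<open>G(I) \<subseteq> H\<close>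
  with \<open>I \<subseteq> \<qq>\<close>, then, since \<open>D/I\<close> is semilocal, every element of \<open>G(\<qq>)\<close> can be reduced modulo \<open>I\<close>
  by elementary matrices in \<open>N\<close> to a conjugate of some \<open>T (a - 1)\<close>, so \<open>G(\<qq>) \<subseteq> H\<close>.

  Consequently the cusp amplitude at \<open>g\<close> splits into its local parts, and the part at a prime \<open>P\<close>
  only depends on \<open>g\<close> modulo the \<open>P\<close>-part of \<open>\<qq>\<close>. As the ideals of a Dedekind domain form a chain
  locally, lifting along \<open>SL2(D) \<rightarrow> SL2(D/\<qq>)\<close> shows that the cusp amplitudes are directed upwards and
  downwards, so there are a largest and a smallest one; the smallest one is the level.

  Under Condition L, differences of squares of units modulo \<open>\<qq>\<close> show that \<open>x\<^sup>2 \<in> \<qq>\<close> for all \<open>x\<close> in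
  the quasi-level. The product of the conjugates of \<open>T x\<close> by \<open>L c\<close> and \<open>L (- c)\<close> then yields
  \<open>2 c\<^sup>2 x\<close> in the quasi-level for all \<open>c\<close>, and hence all multiples of \<open>4 x\<close>, so \<open>x \<in> \<qq>\<close>.
\<close>

section \<open>Ideals of a commutative ring type\<close>

text \<open>The obstacle behind the second half is that the quasi-level is only an additive group:
  an element may not be multiplied by an arbitrary ring element, and conjugation offers only factors
  that are squares of units modulo the level. Ideal multiples have to be manufactured by
  polarization, \<open>(r + 1)^2 - (r - 1)^2 = 4 * r\<close>, which explains the powers of 2 that
  must later be cancelled, and with them the requirement that 2 be invertible modulo the level. Over
  a residue field with three elements every unit has square 1, so differences of unit squares vanish
  there. A prime that occurs at least twice in the level is still under control, because shifting
  units by elements of the radical loses only one power of it; for a prime that occurs exactly once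
  this argument gives nothing, hence clause (ii) of Condition L. Extremal cusp amplitudes come from
  a numerical bound: every amplitude contains the level, so its number of prime factors is bounded,
  whatever the index of \<open>H\<close> and the size of the residue fields.\<close>

lemma
  fixes I :: "'a::comm_ring_1 set"
  assumes "ideal I \<D>"
  shows ideal_0: "0 \<in> I"
    and ideal_add: "\<And>x y. x \<in> I \<Longrightarrow> y \<in> I \<Longrightarrow> x + y \<in> I"
    and ideal_mult_left: "\<And>x r. x \<in> I \<Longrightarrow> r * x \<in> I"
    and ideal_mult_right: "\<And>x r. x \<in> I \<Longrightarrow> x * r \<in> I"
    and ideal_minus: "\<And>x. x \<in> I \<Longrightarrow> - x \<in> I"
    and ideal_diff: "\<And>x y. x \<in> I \<Longrightarrow> y \<in> I \<Longrightarrow> x - y \<in> I"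
proof -
  have *: "0 \<in> I" "\<And>x y. x \<in> I \<Longrightarrow> y \<in> I \<Longrightarrow> x + y \<in> I" "\<And>x r. x \<in> I \<Longrightarrow> r * x \<in> I"
    using assms by (auto simp: ideal_ring_of_type_iff)
  show "0 \<in> I" "\<And>x y. x \<in> I \<Longrightarrow> y \<in> I \<Longrightarrow> x + y \<in> I" "\<And>x r. x \<in> I \<Longrightarrow> r * x \<in> I"
    by fact+
  show "\<And>x r. x \<in> I \<Longrightarrow> x * r \<in> I"
    using *(3) by (simp add: mult.commute)
  show m: "- x \<in> I" if "x \<in> I" for x
    using *(3)[OF that, of "- 1"] by simp
  show "x - y \<in> I" if "x \<in> I" "y \<in> I" for x y
    using *(2)[OF that(1) m[OF that(2)]] by simp
qed

lemma ideal_sum_mem: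
  assumes "ideal I \<D>" "\<And>i. i \<in> A \<Longrightarrow> f i \<in> I"
  shows "sum f A \<in> (I :: 'a::comm_ring_1 set)"
  using assms(2)
  by (induction A rule: infinite_finite_induct) (auto intro: ideal_0[OF assms(1)] ideal_add[OF assms(1)])

lemma ideal_prod_elem_mem:
  assumes "ideal I \<D>" "finite A" "i \<in> A" "f i \<in> I"
  shows "prod f A \<in> (I :: 'a::comm_ring_1 set)"
  using assms by (simp add: prod.remove ideal_mult_right)

lemma ideal_eq_UNIV_iff:
  fixes I :: "'a::comm_ring_1 set"
  assumes "ideal I \<D>"
  shows "I = UNIV \<longleftrightarrow> 1 \<in> I"
  using ideal_mult_left[OF assms, of 1] by auto

lemma ideal_UNIV: "ideal (UNIV :: 'a::comm_ring_1 set) \<D>"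
  and ideal_zero: "ideal ({0} :: 'a::comm_ring_1 set) \<D>"
  and ideal_Int: "ideal I \<D> \<Longrightarrow> ideal J \<D> \<Longrightarrow> ideal (I \<inter> J :: 'a set) \<D>"
  and ideal_principal: "ideal (range ((*) (a :: 'a))) \<D>"
  and ideal_plus: "ideal I \<D> \<Longrightarrow> ideal J \<D> \<Longrightarrow> ideal {x + y | x y. x \<in> I \<and> y \<in> (J :: 'a set)} \<D>"
proof -
  show "ideal (range ((*) a)) \<D>"
    unfolding ideal_ring_of_type_iff
  proof (intro conjI ballI allI)
    show "0 \<in> range ((*) a)"
      by (rule range_eqI[of _ _ 0]) simp
  next
    fix x y assume "x \<in> range ((*) a)" "y \<in> range ((*) a)"
    then show "x + y \<in> range ((*) a)"
      by (auto simp: distrib_left[symmetric])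
  next
    fix x r assume "x \<in> range ((*) a)"
    then show "r * x \<in> range ((*) a)"
      by (auto simp: mult.left_commute)
  qed
  show "ideal {x + y | x y. x \<in> I \<and> y \<in> J} \<D>" if IJ: "ideal I \<D>" "ideal J \<D>"
    unfolding ideal_ring_of_type_iff
  proof (intro conjI ballI allI)
    show "0 \<in> {x + y | x y. x \<in> I \<and> y \<in> J}"
      using ideal_0[OF IJ(1)] ideal_0[OF IJ(2)] by force
  next
    fix u v assume "u \<in> {x + y | x y. x \<in> I \<and> y \<in> J}" "v \<in> {x + y | x y. x \<in> I \<and> y \<in> J}"
    then obtain x y x' y' where "u = x + y" "v = x' + y'" "x \<in> I" "x' \<in> I" "y \<in> J" "y' \<in> J"
      by auto
    then have "u + v = (x + x') + (y + y')" "x + x' \<in> I" "y + y' \<in> J"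
      using ideal_add[OF IJ(1)] ideal_add[OF IJ(2)] by (auto simp: algebra_simps)
    then show "u + v \<in> {x + y | x y. x \<in> I \<and> y \<in> J}" by blast
  next
    fix u r assume "u \<in> {x + y | x y. x \<in> I \<and> y \<in> J}"
    then obtain x y where "u = x + y" "x \<in> I" "y \<in> J"
      by auto
    then have "r * u = r * x + r * y" "r * x \<in> I" "r * y \<in> J"
      using ideal_mult_left[OF IJ(1)] ideal_mult_left[OF IJ(2)] by (auto simp: distrib_left)
    then show "r * u \<in> {x + y | x y. x \<in> I \<and> y \<in> J}" by blast
  qed
qed (auto simp: ideal_ring_of_type_iff)

lemma primeideal_ring_of_type_iff:
  "primeideal (P :: 'a::comm_ring_1 set) \<D> \<longleftrightarrow>
     ideal P \<D> \<and> 1 \<notin> P \<and> (\<forall>a b. a * b \<in> P \<longrightarrow> a \<in> P \<or> b \<in> P)"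
  using cring_from_type_algebra[where ?'a = 'a]
  by (auto simp: primeideal_def primeideal_axioms_def ideal_eq_UNIV_iff[symmetric] eq_commute)

section \<open>Products of ideals and of multisets of ideals\<close>

lemma ideal_prod_eq_commute:
  "ideal_prod \<D> I J = ideal_prod \<D> J (I :: 'a::comm_ring_1 set)"
proof -
  have "x \<in> ideal_prod \<D> J I" if "x \<in> ideal_prod \<D> I J" for x and I J :: "'a set"
    using that
  proof induction
    case (prod i j)
    then show ?case
      using ideal_prod.prod[of j J i I "\<D> :: 'a ring"] by (simp add: mult.commute)
  qed (rule ideal_prod.sum)
  then show ?thesis by blast
qed

lemma ideal_prod_eq_assoc:
  "ideal_prod \<D> (ideal_prod \<D> I J) K = ideal_prod \<D> I (ideal_prod \<D> J (K :: 'a::comm_ring_1 set))"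
proof -
  have sub: "ideal_prod \<D> (ideal_prod \<D> I J) K \<subseteq> ideal_prod \<D> I (ideal_prod \<D> J K)"
    for I J K :: "'a set"
  proof
    fix x assume "x \<in> ideal_prod \<D> (ideal_prod \<D> I J) K"
    then show "x \<in> ideal_prod \<D> I (ideal_prod \<D> J K)"
    proof induction
      case (prod s k)
      from prod(1) show ?case
      proof induction
        case (prod i j)
        have "j * k \<in> ideal_prod \<D> J K"
          using ideal_prod.prod[OF \<open>j \<in> J\<close> \<open>k \<in> K\<close>, of \<D>] by simp
        then show ?case
          using ideal_prod.prod[OF \<open>i \<in> I\<close>, of "j * k" _ \<D>] by (simp add: mult.assoc)
      next
        case (sum s1 s2)
        then show ?case
          using ideal_prod.sum[OF sum.IH] by (simp add: distrib_right)
      qed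
    qed (rule ideal_prod.sum)
  qed
  show ?thesis
    using sub[of I J K] sub[of K J I] by (simp add: ideal_prod_eq_commute)
qed

lemma ideal_ideal_prod:
  "ideal I \<D> \<Longrightarrow> ideal J \<D> \<Longrightarrow> ideal (ideal_prod \<D> I J :: 'a::comm_ring_1 set) \<D>"
  using ring.ideal_prod_is_ideal[OF cring.axioms(1)[OF cring_from_type_algebra]] .

lemma ideal_prod_mem: "x \<in> I \<Longrightarrow> y \<in> J \<Longrightarrow> x * y \<in> ideal_prod \<D> I (J :: 'a::comm_ring_1 set)"
  using ideal_prod.prod[of x I y J \<D>] by simp

lemma ideal_prod_leI:
  fixes I J K :: "'a::comm_ring_1 set"
  assumes "ideal K \<D>" "\<And>x y. x \<in> I \<Longrightarrow> y \<in> J \<Longrightarrow> x * y \<in> K"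
  shows "ideal_prod \<D> I J \<subseteq> K"
proof
  fix x assume "x \<in> ideal_prod \<D> I J"
  then show "x \<in> K"
    by induction (use assms ideal_add in auto)
qed

lemma ideal_prod_le:
  fixes I J :: "'a::comm_ring_1 set"
  shows "ideal I \<D> \<Longrightarrow> ideal_prod \<D> I J \<subseteq> I" "ideal J \<D> \<Longrightarrow> ideal_prod \<D> I J \<subseteq> J"
  by (rule ideal_prod_leI; simp add: ideal_mult_left ideal_mult_right)+

lemma ideal_prod_mono:
  fixes I J :: "'a::comm_ring_1 set"
  assumes "I \<subseteq> I'" "J \<subseteq> J'"
  shows "ideal_prod \<D> I J \<subseteq> ideal_prod \<D> I' J'"
proof
  fix x assume "x \<in> ideal_prod \<D> I J"
  then show "x \<in> ideal_prod \<D> I' J'"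
  proof induction
    case (prod i j)
    then show ?case
      using assms by (auto intro!: ideal_prod_mem)
  qed (rule ideal_prod.sum)
qed

lemma ideal_prod_UNIV: "ideal I \<D> \<Longrightarrow> ideal_prod \<D> I (UNIV :: 'a::comm_ring_1 set) = I"
  using ideal_prod_le(1)[of I UNIV] ideal_prod_mem[of _ I 1 UNIV] by auto

text \<open>Indexing by a multiset turns unique factorization into an equation and divisibility into
  \<open>\<subseteq>#\<close>.\<close>

definition iprod :: "'a::comm_ring_1 set multiset \<Rightarrow> 'a set" where
  "iprod M = fold_mset (ideal_prod \<D>) UNIV M"

interpretation iprod: comp_fun_commute "ideal_prod (\<D> :: 'a::comm_ring_1 ring)"
proof
  fix I J :: "'a set"
  show "ideal_prod \<D> I \<circ> ideal_prod \<D> J = ideal_prod \<D> J \<circ> ideal_prod \<D> I"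
    by (simp add: fun_eq_iff ideal_prod_eq_assoc[symmetric] ideal_prod_eq_commute[of I J])
qed

lemma iprod_empty [simp]: "iprod {#} = UNIV"
  and iprod_add_mset [simp]: "iprod (add_mset P M) = ideal_prod \<D> P (iprod M)"
  by (simp_all add: iprod_def)

lemma iprod_mset: "iprod (mset ps) = foldr (ideal_prod \<D>) ps UNIV"
  by (induction ps) auto

lemma ideal_iprod: "(\<And>P. P \<in># M \<Longrightarrow> ideal P \<D>) \<Longrightarrow> ideal (iprod M) \<D>"
  by (induction M) (auto intro: ideal_UNIV ideal_ideal_prod)

lemma iprod_union:
  assumes "\<And>P. P \<in># M \<Longrightarrow> ideal P \<D>" "\<And>P. P \<in># N \<Longrightarrow> ideal P \<D>"
  shows "iprod (M + N) = ideal_prod \<D> (iprod M) (iprod N)"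
  using assms(1)
proof (induction M)
  case empty
  then show ?case
    using ideal_prod_UNIV[OF ideal_iprod[OF assms(2)]] by (simp add: ideal_prod_eq_commute)
qed (simp add: ideal_prod_eq_assoc)

section \<open>Dedekind domains\<close>

text \<open>Scaling by a non-zero element of a domain is injective, so this takes the place of
  division by a principal ideal.\<close>

lemma ideal_prod_principal:
  fixes J :: "'a::comm_ring_1 set"
  assumes J: "ideal J \<D>"
  shows "ideal_prod \<D> (range ((*) a)) J = (*) a ` J"
proof
  show "ideal_prod \<D> (range ((*) a)) J \<subseteq> (*) a ` J"
  proof
    fix x assume "x \<in> ideal_prod \<D> (range ((*) a)) J"
    then show "x \<in> (*) a ` J"
    proof induction
      case (prod i j)
      then show ?case
        using ideal_mult_left[OF J] by (auto simp: mult.assoc)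
    next
      case (sum s1 s2)
      then show ?case
        using ideal_add[OF J] by (auto simp: distrib_left[symmetric])
    qed
  qed
  show "(*) a ` J \<subseteq> ideal_prod \<D> (range ((*) a)) J"
    using ideal_prod_mem[of a "range ((*) a)" _ J] range_eqI[of a "(*) a" 1] by auto
qed

lemma primeideal_ideal_prod_subset:
  fixes P I J :: "'a::comm_ring_1 set"
  assumes P: "primeideal P \<D>" and "ideal_prod \<D> I J \<subseteq> P"
  shows "I \<subseteq> P \<or> J \<subseteq> P"
proof (rule ccontr)
  assume "\<not> (I \<subseteq> P \<or> J \<subseteq> P)"
  then obtain x y where xy: "x \<in> I" "y \<in> J" "x \<notin> P" "y \<notin> P"
    by auto
  then have "x * y \<in> P"
    using assms(2) ideal_prod_mem by blast
  then show False
    using P xy by (auto simp: primeideal_ring_of_type_iff)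
qed

locale dedekind =
  fixes ty :: "'a::idom itself"
  assumes dedekind: "dedekind_domain TYPE('a)"
begin

lemma noetherian: "noetherian_ring (\<D> :: 'a ring)"
  using dedekind by (simp add: dedekind_domain_def noetherian_domain_def)

text \<open>A maximal counterexample exists: by the ascending chain condition the union of a chain
  of ideals belongs to the chain, so Zorn applies to the set of counterexamples.\<close>

lemma noetherian_induct [consumes 1, case_names step]:
  fixes I :: "'a set"
  assumes "ideal I \<D>"
    and step: "\<And>I. ideal I \<D> \<Longrightarrow> (\<And>J. ideal J \<D> \<Longrightarrow> I \<subset> J \<Longrightarrow> Q J) \<Longrightarrow> Q I"
  shows "Q I"
proof (rule ccontr)
  define S where "S = {I :: 'a set. ideal I \<D> \<and> \<not> Q I}"
  assume "\<not> Q I"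
  then have "S \<noteq> {}"
    using assms(1) by (auto simp: S_def)
  then have "\<exists>M\<in>S. \<forall>N\<in>S. M \<subseteq> N \<longrightarrow> N = M"
  proof (rule subset_Zorn_nonempty)
    fix C assume C: "C \<noteq> {}" "subset.chain S C"
    then have "subset.chain {I. ideal I \<D>} C"
      by (auto simp: subset_chain_def S_def)
    then have "\<Union>C \<in> C"
      using noetherian_ring.ideal_chain_is_trivial[OF noetherian C(1)] by simp
    then show "\<Union>C \<in> S"
      using C(2) by (auto simp: subset_chain_def)
  qed
  then obtain M where "M \<in> S" "\<And>N. N \<in> S \<Longrightarrow> M \<subseteq> N \<Longrightarrow> N = M"
    by blast
  then show False
    using step[of M] by (auto simp: S_def)
qed

text \<open>The witnesses are \<open>I + (a)\<close> and \<open>I + (b)\<close>, where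
  \<open>a * b\<close> violates primality. This is the splitting step of the inductions that search
  for primes.\<close>

lemma not_prime_split:
  fixes I :: "'a set"
  assumes I: "ideal I \<D>" "1 \<notin> I" "\<not> primeideal I \<D>"
  obtains J K where "ideal J \<D>" "ideal K \<D>" "I \<subset> J" "I \<subset> K" "ideal_prod \<D> J K \<subseteq> I"
proof -
  obtain a b where ab: "a * b \<in> I" "a \<notin> I" "b \<notin> I"
    using I by (auto simp: primeideal_ring_of_type_iff)
  define S where "S c = {x + y | x y. x \<in> I \<and> y \<in> range ((*) c)}" for c
  have ideal: "ideal (S c) \<D>" for c
    unfolding S_def by (rule ideal_plus[OF I(1) ideal_principal])
  have sub: "I \<subset> S c" if "c \<notin> I" for c
  proof
    show "I \<subseteq> S c"
      unfolding S_def by (auto intro!: exI[of _ _] range_eqI[of _ _ 0])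
    have "c \<in> S c"
      unfolding S_def using ideal_0[OF I(1)] by (force intro: range_eqI[of _ _ 1])
    then show "I \<noteq> S c"
      using that by blast
  qed
  have "ideal_prod \<D> (S a) (S b) \<subseteq> I"
  proof (rule ideal_prod_leI[OF I(1)])
    fix x y assume "x \<in> S a" "y \<in> S b"
    then obtain i j r s where *: "x = i + a * r" "y = j + b * s" "i \<in> I" "j \<in> I"
      by (auto simp: S_def)
    then have "x * y = i * y + j * (a * r) + (r * s) * (a * b)"
      by (simp add: algebra_simps)
    then show "x * y \<in> I"
      using * ab(1) I(1) by (simp add: ideal_add ideal_mult_left ideal_mult_right)
  qed
  then show ?thesis
    using that ideal sub ab by blast
qed

lemma exists_prime_above:
  fixes I :: "'a set"
  assumes "ideal I \<D>" "1 \<notin> I"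
  shows "\<exists>P. primeideal P \<D> \<and> I \<subseteq> P"
  using assms
proof (induction rule: noetherian_induct)
  case (step I)
  show ?case
  proof (cases "primeideal I \<D>")
    case False
    then obtain J K where JK: "ideal J \<D>" "ideal K \<D>" "I \<subset> J" "I \<subset> K" "ideal_prod \<D> J K \<subseteq> I"
      using not_prime_split step by blast
    \<comment> \<open>If both were the whole ring, \<open>1 * 1\<close> would lie in
      \<open>I\<close>.\<close>
    then have "1 \<notin> J \<or> 1 \<notin> K"
      using ideal_prod_mem[of 1 J 1 K] step(3) by auto
    then show ?thesis
      using step(2)[of J] step(2)[of K] JK by blast
  qed auto
qed

section \<open>Non-zero primes in dimension one\<close>

definition primes :: "'a set set" where
  "primes = {P. primeideal P \<D> \<and> P \<noteq> {0}}"

lemma primesD: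
  assumes "P \<in> primes"
  shows "primeideal P \<D>" "ideal P \<D>" "1 \<notin> P" "P \<noteq> {0}"
    "\<And>a b. a * b \<in> P \<Longrightarrow> a \<in> P \<or> b \<in> P"
  using assms by (auto simp: primes_def primeideal_ring_of_type_iff)

text \<open>In a domain \<open>{0}\<close> is prime, so a strict inclusion of primes above a
  non-zero one would extend to a chain of length two.\<close>

lemma prime_maximal:
  assumes "P \<in> primes" "primeideal P' \<D>" "P \<subseteq> P'"
  shows "P' = P"
proof (rule ccontr)
  assume "P' \<noteq> P"
  define C where "C = (\<lambda>n::nat. if n = 0 then {0} else if n = 1 then P else P' :: 'a set)"
  have "primeideal ({0} :: 'a set) \<D>"
    using ideal_zero by (auto simp: primeideal_ring_of_type_iff)
  then have "(\<forall>i\<le>2. primeideal (C i) \<D>)"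
    using assms by (simp add: C_def primes_def)
  moreover have "{0} \<subset> P" "P \<subset> P'"
    using assms \<open>P' \<noteq> P\<close> ideal_0[OF primesD(2), of P] primesD(4)[of P] by auto
  then have "\<forall>i<2. C i \<subset> C (Suc i)"
    by (simp add: C_def numeral_2_eq_2 less_Suc_eq)
  ultimately have "enat 2 \<le> krull_dim (\<D> :: 'a ring)"
    unfolding krull_dim_def by (intro Sup_upper) blast
  then show False
    using dedekind by (simp add: dedekind_domain_def one_enat_def)
qed

lemma ideal_above_prime:
  assumes "P \<in> primes" "ideal I \<D>" "P \<subseteq> I" "\<not> I \<subseteq> P"
  shows "I = UNIV"
  using exists_prime_above[OF assms(2)] prime_maximal[OF assms(1)] assms
  by (metis ideal_eq_UNIV_iff order_trans)

lemma prime_inverse: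
  assumes P: "P \<in> primes" and "x \<notin> P"
  shows "\<exists>y. x * y - 1 \<in> P"
proof -
  define I where "I = {u + v | u v. u \<in> P \<and> v \<in> range ((*) x)}"
  have "ideal I \<D>"
    unfolding I_def by (rule ideal_plus[OF primesD(2)[OF P] ideal_principal])
  moreover have "P \<subseteq> I"
  proof
    fix u assume "u \<in> P"
    moreover have "u = u + x * 0" by simp
    ultimately show "u \<in> I" unfolding I_def by blast
  qed
  moreover have "x \<in> I"
  proof -
    have "x = 0 + x * 1" by simp
    then show ?thesis
      unfolding I_def using ideal_0[OF primesD(2)[OF P]] by blast
  qed
  ultimately have "1 \<in> I"
    using ideal_above_prime[OF P] assms(2) by blast
  then obtain u y where "1 = u + x * y" "u \<in> P"
    by (auto simp: I_def)
  then have "x * y - 1 = - u"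
    by (simp add: algebra_simps)
  then show ?thesis
    using ideal_minus[OF primesD(2)[OF P] \<open>u \<in> P\<close>] by metis
qed

text \<open>A prime above a product contains one of the factors, and by maximality it equals that
  factor.\<close>

lemma iprod_subset_prime:
  assumes "set_mset M \<subseteq> primes" "P \<in> primes" "iprod M \<subseteq> P"
  shows "P \<in># M"
  using assms
proof (induction M)
  case empty
  then show ?case
    using primesD(3) by auto
next
  case (add R M)
  then have "R \<subseteq> P \<or> iprod M \<subseteq> P"
    using primeideal_ideal_prod_subset[OF primesD(1)[OF add.prems(2)], of R "iprod M"] by simp
  then show ?case
    using add prime_maximal[of R P] primesD(1) by auto
qed

lemma ideal_iprod_primes: "set_mset M \<subseteq> primes \<Longrightarrow> ideal (iprod M) \<D>"
  by (rule ideal_iprod) (auto intro: primesD)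

lemma ideal_prod_eq_0:
  fixes I J :: "'a set"
  assumes "ideal I \<D>" "ideal J \<D>" "ideal_prod \<D> I J = {0}"
  shows "I = {0} \<or> J = {0}"
  using ideal_prod_mem[of _ I _ J] assms ideal_0 by (auto simp: set_eq_iff)

text \<open>A first approximation to factorization, by containment only and before primes are known
  to be invertible. It feeds the construction of the inverse of a prime.\<close>

lemma exists_iprod_subset:
  assumes "ideal I \<D>" "I \<noteq> {0}"
  shows "\<exists>M. set_mset M \<subseteq> primes \<and> iprod M \<subseteq> I"
  using assms
proof (induction rule: noetherian_induct)
  case (step I)
  consider "1 \<in> I" | "1 \<notin> I" "primeideal I \<D>" | "1 \<notin> I" "\<not> primeideal I \<D>"
    by blast
  then show ?case
  proof cases
    case 1
    then show ?thesis
      using ideal_eq_UNIV_iff[OF step(1)] by (intro exI[of _ "{#}"]) auto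
  next
    case 2
    then show ?thesis
      using step(3) ideal_prod_UNIV[OF step(1)] by (intro exI[of _ "{#I#}"]) (simp add: primes_def)
  next
    case 3
    then obtain J K where JK: "ideal J \<D>" "ideal K \<D>" "I \<subset> J" "I \<subset> K" "ideal_prod \<D> J K \<subseteq> I"
      using not_prime_split step by blast
    have "J \<noteq> {0}" "K \<noteq> {0}"
      using JK ideal_0[OF step(1)] by blast+
    then obtain M N where MN: "set_mset M \<subseteq> primes" "iprod M \<subseteq> J" "set_mset N \<subseteq> primes" "iprod N \<subseteq> K"
      using step(2)[OF JK(1,3)] step(2)[OF JK(2,4)] by blast
    then have "iprod (M + N) = ideal_prod \<D> (iprod M) (iprod N)"
      by (intro iprod_union) (auto intro: primesD)
    also have "\<dots> \<subseteq> I"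
      using ideal_prod_mono[OF MN(2,4)] JK(5) by blast
    finally show ?thesis
      using MN by (intro exI[of _ "M + N"]) auto
  qed
qed

text \<open>
  If \<open>b / a\<close> maps a non-zero ideal into itself, then it is integral: for \<open>c \<noteq> 0\<close> in the ideal, the
  elements \<open>(b / a)^n c\<close> generate a finitely generated ideal, which gives a monic equation.
\<close>

lemma integrally_closed_divides:
  fixes a b :: 'a
  assumes "a \<noteq> 0" and I: "ideal I \<D>" "I \<noteq> {0}" and ex: "\<And>x. x \<in> I \<Longrightarrow> \<exists>y\<in>I. b * x = a * y"
  shows "b \<in> range ((*) a)"
proof -
  obtain c where c: "c \<in> I" "c \<noteq> 0"
    using I ideal_0 by blast
  obtain f where f: "\<And>x. x \<in> I \<Longrightarrow> f x \<in> I \<and> b * x = a * f x"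
    using ex by metis
  define y where "y n = (f ^^ n) c" for n
  have y: "y n \<in> I" for n
    by (induction n) (simp_all add: y_def c f)
  have ySuc: "b * y n = a * y (Suc n)" for n
    using f[OF y[of n]] by (simp add: y_def)
  define z where "z = to_fract b / to_fract a"
  have yz: "to_fract (y n) = z ^ n * to_fract c" for n
  proof (induction n)
    case (Suc n)
    have "to_fract a * to_fract (y (Suc n)) = to_fract b * to_fract (y n)"
      using ySuc[of n] by (simp flip: to_fract_mult)
    then show ?case
      using Suc \<open>a \<noteq> 0\<close> by (simp add: z_def field_simps)
  qed (simp add: y_def)
  define J where "J n = {\<Sum>i<n. d i * y i | d. True}" for n
  have J: "ideal (J n) \<D>" for n
    unfolding ideal_ring_of_type_iff
  proof (intro conjI ballI allI)
    show "0 \<in> J n"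
      unfolding J_def by (auto intro!: exI[of _ "\<lambda>_. 0"])
    show "u + v \<in> J n" if uv: "u \<in> J n" "v \<in> J n" for u v
    proof -
      obtain d e where "u = (\<Sum>i<n. d i * y i)" "v = (\<Sum>i<n. e i * y i)"
        using uv unfolding J_def by blast
      then have "u + v = (\<Sum>i<n. (d i + e i) * y i)"
        by (simp add: distrib_right sum.distrib)
      then show ?thesis
        unfolding J_def by (auto intro!: exI[of _ "\<lambda>i. d i + e i"])
    qed
    show "r * u \<in> J n" if u: "u \<in> J n" for u r
    proof -
      obtain d where "u = (\<Sum>i<n. d i * y i)"
        using u unfolding J_def by blast
      then have "r * u = (\<Sum>i<n. (r * d i) * y i)"
        by (simp add: sum_distrib_left mult.assoc)
      then show ?thesis
        unfolding J_def by (auto intro!: exI[of _ "\<lambda>i. r * d i"])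
    qed
  qed
  have J_Suc: "J n \<subseteq> J (Suc n)" for n
  proof
    fix u assume "u \<in> J n"
    then obtain d where d: "u = (\<Sum>i<n. d i * y i)"
      unfolding J_def by blast
    then have "u = (\<Sum>i<Suc n. (d(n := 0)) i * y i)"
      by simp
    then show "u \<in> J (Suc n)"
      unfolding J_def by blast
  qed
  then have J_mono: "m \<le> n \<Longrightarrow> J m \<subseteq> J n" for m n
    by (rule lift_Suc_mono_le)
  \<comment> \<open>Once the chain is stationary, \<open>y n\<close> lies in the span of the earlier
    \<open>y i\<close>; cancelling \<open>c\<close> makes this a monic equation of degree
    \<open>n\<close> for \<open>z\<close>.\<close>
  have "\<Union>(range J) \<in> range J"
  proof (rule noetherian_ring.ideal_chain_is_trivial[OF noetherian])
    show "subset.chain {I. ideal I \<D>} (range J)"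
      unfolding subset_chain_def using J J_mono by (auto simp: image_iff) (metis linorder_le_cases subsetD)
  qed simp
  then obtain n where n: "\<And>m. J m \<subseteq> J n"
    by auto
  have "y n = (\<Sum>i<Suc n. (if i = n then 1 else 0) * y i)"
    by simp
  then have "y n \<in> J (Suc n)"
    unfolding J_def mem_Collect_eq by (intro exI conjI TrueI)
  then obtain d where d: "y n = (\<Sum>i<n. d i * y i)"
    using n[of "Suc n"] by (auto simp: J_def)
  have "z ^ n * to_fract c = (\<Sum>i<n. to_fract (d i) * z ^ i) * to_fract c"
  proof -
    have to_sum: "to_fract (sum g A) = (\<Sum>i\<in>A. to_fract (g i))" for g :: "nat \<Rightarrow> 'a" and A
      by (induction A rule: infinite_finite_induct) auto
    have "to_fract (y n) = (\<Sum>i<n. to_fract (d i) * to_fract (y i))"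
      unfolding d to_sum by simp
    then show ?thesis
      unfolding yz by (simp add: sum_distrib_right mult.assoc)
  qed
  then have zn: "z ^ n = (\<Sum>i<n. to_fract (d i) * z ^ i)"
    using c by simp
  define p where "p = monom 1 n - (\<Sum>i<n. monom (d i) i)"
  have coeff_p: "coeff p i = (if i = n then 1 else if i < n then - d i else 0)" for i
    by (auto simp: p_def Polynomial.coeff_sum Polynomial.coeff_monom)
  have deg_p: "Polynomial.degree p = n"
    using coeff_p by (intro antisym Polynomial.degree_le le_degree) auto
  have "poly (map_poly to_fract p) z = (\<Sum>i\<le>n. to_fract (coeff p i) * z ^ i)"
    by (simp add: poly_altdef deg_p coeff_map_poly degree_map_poly)
  also have "\<dots> = (\<Sum>i<n. - (to_fract (d i) * z ^ i)) + z ^ n"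
    unfolding lessThan_Suc_atMost[symmetric] by (simp add: coeff_p)
  also have "\<dots> = 0"
    by (simp add: zn sum_negf)
  finally have "integral_over_base z"
    unfolding integral_over_base_def using coeff_p deg_p by (intro exI[of _ p]) simp
  then obtain x where "z = to_fract x"
    using dedekind by (auto simp: dedekind_domain_def integrally_closed_def)
  then have "to_fract b = to_fract (a * x)"
    using \<open>a \<noteq> 0\<close> by (simp add: z_def field_simps)
  then show ?thesis
    unfolding to_fract_eq_iff by blast
qed

text \<open>The fraction \<open>b / a\<close> lies in the inverse of \<open>P\<close> but not in the
  ring. Among the products of primes inside \<open>(a)\<close> take a shortest one; \<open>P\<close>
  is one of its factors, and the product of the others, being too short to lie in
  \<open>(a)\<close>, supplies \<open>b\<close>.\<close>

lemma prime_fractional_element: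
  assumes P: "P \<in> primes"
  obtains a b where "a \<noteq> 0" "a \<in> P" "b \<notin> range ((*) a)" "\<And>x. x \<in> P \<Longrightarrow> b * x \<in> range ((*) a)"
proof -
  obtain a where a: "a \<in> P" "a \<noteq> 0"
    using primesD[OF P] ideal_0 by blast
  define Q where "Q M \<longleftrightarrow> set_mset M \<subseteq> primes \<and> iprod M \<subseteq> range ((*) a)" for M
  have "a \<in> range ((*) a)"
    by (rule range_eqI[of _ _ 1]) simp
  then have "range ((*) a) \<noteq> {0}"
    using a by auto
  then have "\<exists>M. Q M"
    unfolding Q_def using exists_iprod_subset[OF ideal_principal] by blast
  then obtain M where M: "Q M" "\<And>N. Q N \<Longrightarrow> size M \<le> size N"
    using exists_least_iff[of "\<lambda>n. \<exists>M. Q M \<and> size M = n"] by (metis linorder_not_less)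
  have "range ((*) a) \<subseteq> P"
    using a ideal_mult_right[OF primesD(2)[OF P]] by auto
  then have "P \<in># M"
    using M(1) iprod_subset_prime[OF _ P, of M] by (auto simp: Q_def)
  then obtain N where N: "M = add_mset P N"
    by (metis insert_DiffM)
  then have "\<not> Q N"
    using M(2)[of N] by auto
  then obtain b where b: "b \<in> iprod N" "b \<notin> range ((*) a)"
    using M(1) N by (auto simp: Q_def)
  have "b * x \<in> range ((*) a)" if "x \<in> P" for x
    using ideal_prod_mem[OF that b(1)] M(1) N by (auto simp: Q_def mult.commute)
  then show ?thesis
    using that a b by blast
qed

text \<open>\<open>P'\<close> is \<open>a\<close> times the fractional inverse of \<open>P\<close>,
  which expresses invertibility by ideals of the ring itself. The quotient \<open>J\<close> of
  \<open>P' P\<close> by \<open>a\<close> contains \<open>P\<close>; were it contained in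
  \<open>P\<close>, then \<open>b / a\<close> would map \<open>P\<close> into itself and lie in the
  ring by integral closedness. By maximality of \<open>P\<close>, \<open>J\<close> is the whole
  ring.\<close>

lemma prime_pseudo_inverse:
  assumes P: "P \<in> primes"
  obtains a b P' where "a \<noteq> 0" "ideal P' \<D>" "ideal_prod \<D> P' P = range ((*) a)"
    "a \<in> P'" "b \<in> P'" "b \<notin> range ((*) a)"
proof -
  obtain a b where ab: "a \<noteq> 0" "a \<in> P" "b \<notin> range ((*) a)" "\<And>x. x \<in> P \<Longrightarrow> b * x \<in> range ((*) a)"
    using prime_fractional_element[OF P] by metis
  note aD = ideal_principal[of a]
  define P' where "P' = {x. \<forall>y\<in>P. x * y \<in> range ((*) a)}"
  have P': "ideal P' \<D>"
    unfolding ideal_ring_of_type_iff P'_def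
    using ideal_0[OF aD] ideal_add[OF aD] ideal_mult_left[OF aD]
    by (auto simp: distrib_right mult.assoc simp del: image_iff)
  define J where "J = {c. a * c \<in> ideal_prod \<D> P' P}"
  note PP = ideal_ideal_prod[OF P' primesD(2)[OF P]]
  have J: "ideal J \<D>"
    unfolding ideal_ring_of_type_iff J_def
    using ideal_0[OF PP] ideal_add[OF PP] ideal_mult_left[OF PP]
    by (auto simp: distrib_left mult.left_commute)
  have "a \<in> P'" "b \<in> P'"
    using ab by (auto simp: P'_def)
  have le: "ideal_prod \<D> P' P \<subseteq> range ((*) a)"
    by (rule ideal_prod_leI[OF aD]) (auto simp: P'_def)
  have "P \<subseteq> J"
    using ideal_prod_mem[OF \<open>a \<in> P'\<close>] by (auto simp: J_def)
  moreover have "\<not> J \<subseteq> P"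
  proof
    assume "J \<subseteq> P"
    have "\<exists>y\<in>P. b * x = a * y" if "x \<in> P" for x
    proof -
      have "b * x \<in> ideal_prod \<D> P' P"
        by (rule ideal_prod_mem[OF \<open>b \<in> P'\<close> that])
      moreover have "\<exists>y. b * x = a * y"
        using ab(4)[OF that] by auto
      ultimately show ?thesis
        using \<open>J \<subseteq> P\<close> by (auto simp: J_def)
    qed
    then show False
      using integrally_closed_divides[OF ab(1) primesD(2,4)[OF P], of b] ab(3) by blast
  qed
  ultimately have "J = UNIV"
    using ideal_above_prime[OF P J] by blast
  then have "range ((*) a) \<subseteq> ideal_prod \<D> P' P"
    by (auto simp: J_def)
  then show ?thesis
    using that ab P' le \<open>a \<in> P'\<close> \<open>b \<in> P'\<close> by blast
qed

section \<open>Unique factorization of ideals\<close>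

lemma prime_cancel:
  assumes P: "P \<in> primes" and I: "ideal I \<D>" "ideal J \<D>" and le: "ideal_prod \<D> P I \<subseteq> ideal_prod \<D> P J"
  shows "I \<subseteq> J"
proof -
  obtain a b P' where P': "a \<noteq> 0" "ideal P' \<D>" "ideal_prod \<D> P' P = range ((*) a)"
    using prime_pseudo_inverse[OF P] by metis
  \<comment> \<open>Multiplying by \<open>P'\<close> turns the factor \<open>P\<close> into the
    scalar \<open>a\<close>, which can be cancelled.\<close>
  have "ideal_prod \<D> (ideal_prod \<D> P' P) I \<subseteq> ideal_prod \<D> (ideal_prod \<D> P' P) J"
    unfolding ideal_prod_eq_assoc by (rule ideal_prod_mono[OF order_refl le])
  then have "(*) a ` I \<subseteq> (*) a ` J"
    unfolding P'(3) ideal_prod_principal[OF I(1)] ideal_prod_principal[OF I(2)] .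
  then show ?thesis
    using P'(1) by auto
qed

text \<open>The ideal \<open>J\<close> of the proof is \<open>I\<close> times the inverse of a prime
  \<open>P\<close> above \<open>I\<close>. It is strictly larger than \<open>I\<close>, so it
  factors by induction, and \<open>I\<close> is the product of \<open>J\<close> and
  \<open>P\<close>.\<close>

lemma exists_factorization:
  assumes "ideal I \<D>" "I \<noteq> {0}"
  shows "\<exists>M. set_mset M \<subseteq> primes \<and> iprod M = I"
  using assms
proof (induction rule: noetherian_induct)
  case (step I)
  show ?case
  proof (cases "1 \<in> I")
    case True
    then show ?thesis
      using ideal_eq_UNIV_iff[OF step(1)] by (intro exI[of _ "{#}"]) auto
  next
    case False
    then obtain P where "primeideal P \<D>" "I \<subseteq> P"
      using exists_prime_above[OF step(1)] by blast
    then have P: "P \<in> primes" "I \<subseteq> P"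
      using step(3) ideal_0[OF step(1)] by (auto simp: primes_def)
    then obtain a b P' where P': "a \<noteq> 0" "ideal P' \<D>" "ideal_prod \<D> P' P = range ((*) a)"
      "a \<in> P'" "b \<in> P'" "b \<notin> range ((*) a)"
      using prime_pseudo_inverse by metis
    define IP where "IP = ideal_prod \<D> I P'"
    have IP: "ideal IP \<D>"
      unfolding IP_def by (rule ideal_ideal_prod[OF step(1) P'(2)])
    have IP_le: "IP \<subseteq> range ((*) a)"
      unfolding IP_def using ideal_prod_mono[OF P(2) order_refl, of P'] P'(3)
      by (simp add: ideal_prod_eq_commute)
    have IPP: "ideal_prod \<D> IP P = (*) a ` I"
      unfolding IP_def ideal_prod_eq_assoc P'(3)
      using ideal_prod_principal[OF step(1), of a] by (simp add: ideal_prod_eq_commute)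
    define J where "J = {c. a * c \<in> IP}"
    have J: "ideal J \<D>"
      unfolding ideal_ring_of_type_iff J_def
      using ideal_0[OF IP] ideal_add[OF IP] ideal_mult_left[OF IP]
      by (auto simp: distrib_left mult.left_commute)
    have IPJ: "IP = (*) a ` J"
      using IP_le by (auto simp: J_def)
    then have IPJ': "IP = ideal_prod \<D> (range ((*) a)) J"
      by (simp add: ideal_prod_principal[OF J])
    have "(*) a ` (ideal_prod \<D> J P) = ideal_prod \<D> IP P"
      unfolding IPJ' ideal_prod_eq_assoc
      using ideal_prod_principal[OF ideal_ideal_prod[OF J primesD(2)[OF P(1)]]] by simp
    then have JP: "ideal_prod \<D> J P = I"
      unfolding IPP using P'(1) by (simp add: inj_image_eq_iff inj_def)
    have "I \<subseteq> J"
      using ideal_prod_mem[OF _ P'(4)] by (auto simp: J_def IP_def mult.commute)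
    \<comment> \<open>Equality would make \<open>b / a\<close> map \<open>I\<close> into itself and
      hence lie in the ring.\<close>
    moreover have "I \<noteq> J"
    proof
      assume "I = J"
      have "\<exists>y\<in>I. b * x = a * y" if "x \<in> I" for x
      proof -
        have "b * x \<in> IP"
          using ideal_prod_mem[OF that P'(5)] by (simp add: IP_def mult.commute)
        then show ?thesis
          unfolding IPJ \<open>I = J\<close> by auto
      qed
      then show False
        using integrally_closed_divides[OF P'(1) step(1,3), of b] P'(6) by blast
    qed
    ultimately have "I \<subset> J" "J \<noteq> {0}"
      using step(3) ideal_0[OF step(1)] by blast+
    then obtain M where "set_mset M \<subseteq> primes" "iprod M = J"
      using step(2)[OF J] by blast
    then show ?thesis
      using P JP by (intro exI[of _ "add_mset P M"]) (simp add: ideal_prod_eq_commute)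
  qed
qed

text \<open>Cancelling the primes of \<open>N\<close> one after the other reduces containment to the
  fact that a prime above a product is one of its factors. Used in both directions this gives
  uniqueness of the factorization.\<close>

lemma iprod_subset_iff:
  assumes "set_mset M \<subseteq> primes" "set_mset N \<subseteq> primes"
  shows "iprod M \<subseteq> iprod N \<longleftrightarrow> N \<subseteq># M"
proof
  assume "N \<subseteq># M"
  then obtain K where K: "M = N + K"
    by (metis subset_mset.add_diff_inverse)
  then have "iprod M = ideal_prod \<D> (iprod N) (iprod K)"
    using assms by (simp, intro iprod_union) (auto intro: primesD)
  then show "iprod M \<subseteq> iprod N"
    using ideal_prod_le(1)[OF ideal_iprod_primes[OF assms(2)]] by simp
next
  show "iprod M \<subseteq> iprod N \<Longrightarrow> N \<subseteq># M"
    using assms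
  proof (induction N arbitrary: M)
    case (add P N)
    have "iprod M \<subseteq> P"
      using add.prems ideal_prod_le(1)[OF primesD(2), of P "iprod N"] by auto
    then have "P \<in># M"
      using add.prems iprod_subset_prime by auto
    then obtain K where K: "M = add_mset P K"
      by (metis insert_DiffM)
    then have "iprod K \<subseteq> iprod N"
      using add.prems prime_cancel[of P "iprod K" "iprod N"] ideal_iprod_primes by auto
    then show ?case
      using add K by auto
  qed simp
qed

lemma iprod_nonzero: "set_mset M \<subseteq> primes \<Longrightarrow> iprod M \<noteq> {0}"
proof (induction M)
  case (add P M)
  then show ?case
    using ideal_prod_eq_0[of P "iprod M"] primesD ideal_iprod_primes by auto
qed (auto simp: set_eq_iff intro: exI[of _ 1])

text \<open>For a non-zero ideal the choice is unique by \<open>factors_iprod\<close>; the value at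
  the zero ideal carries no information.\<close>

definition factors :: "'a set \<Rightarrow> 'a set multiset" where
  "factors I = (SOME M. set_mset M \<subseteq> primes \<and> iprod M = I)"

lemma factors:
  assumes "ideal I \<D>" "I \<noteq> {0}"
  shows "set_mset (factors I) \<subseteq> primes" "iprod (factors I) = I"
  using someI_ex[OF exists_factorization[OF assms]] by (auto simp: factors_def)

lemma factors_iprod:
  assumes "set_mset M \<subseteq> primes"
  shows "factors (iprod M) = M"
proof -
  note * = factors[OF ideal_iprod_primes[OF assms] iprod_nonzero[OF assms]]
  then show ?thesis
    using iprod_subset_iff[OF assms *(1)] iprod_subset_iff[OF *(1) assms]
    by (simp add: subset_mset.antisym)
qed

lemma factors_subset_iff:
  assumes "ideal I \<D>" "I \<noteq> {0}" "ideal J \<D>" "J \<noteq> {0}"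
  shows "I \<subseteq> J \<longleftrightarrow> factors J \<subseteq># factors I"
  using iprod_subset_iff[OF factors(1)[OF assms(1,2)] factors(1)[OF assms(3,4)]]
  by (simp add: factors(2) assms)

lemma factors_ideal_prod:
  assumes "ideal I \<D>" "I \<noteq> {0}" "ideal J \<D>" "J \<noteq> {0}"
  shows "factors (ideal_prod \<D> I J) = factors I + factors J"
proof -
  note * = factors[OF assms(1,2)] factors[OF assms(3,4)]
  have "iprod (factors I + factors J) = ideal_prod \<D> I J"
    using iprod_union[of "factors I" "factors J"] * primesD(2) by (simp add: subset_iff)
  then show ?thesis
    using factors_iprod[of "factors I + factors J"] * by simp
qed

lemma factors_prime: "P \<in> primes \<Longrightarrow> factors P = {#P#}"
  using factors_iprod[of "{#P#}"] ideal_prod_UNIV[OF primesD(2), of P] by simp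

lemma in_factors_iff:
  assumes "ideal I \<D>" "I \<noteq> {0}"
  shows "P \<in># factors I \<longleftrightarrow> P \<in> primes \<and> I \<subseteq> P"
proof (cases "P \<in> primes")
  case True
  then show ?thesis
    using factors_subset_iff[OF assms primesD(2,4)[OF True]] by (simp add: factors_prime)
next
  case False
  then show ?thesis
    using factors(1)[OF assms] by auto
qed

lemma prime_ideal_ord_eq:
  assumes "ideal I \<D>" "I \<noteq> {0}"
  shows "prime_ideal_ord P I = count (factors I) P"
  unfolding prime_ideal_ord_def
proof (rule the_equality)
  obtain ps where "mset ps = factors I"
    using ex_mset by blast
  then show "\<exists>ps. (\<forall>P\<in>set ps. primeideal P \<D>) \<and> foldr (ideal_prod \<D>) ps UNIV = I \<and>
      count_list ps P = count (factors I) P"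
    using factors[OF assms] primesD(1)
    by (intro exI[of _ ps]) (auto simp: iprod_mset[symmetric] set_mset_mset[symmetric]
        count_mset[symmetric] simp del: set_mset_mset count_mset)
next
  fix n assume "\<exists>ps. (\<forall>P\<in>set ps. primeideal P \<D>) \<and> foldr (ideal_prod \<D>) ps UNIV = I \<and>
      count_list ps P = n"
  then obtain ps where ps: "\<forall>P\<in>set ps. primeideal P \<D>" "iprod (mset ps) = I" "count_list ps P = n"
    by (auto simp: iprod_mset)
  \<comment> \<open>\<open>primeideal\<close> admits the zero ideal of a domain, so the list could
    contain it; the product would then be zero.\<close>
  have "{0} \<notin> set ps"
  proof
    assume "{0} \<in> set ps"
    then obtain N where N: "mset ps = add_mset {0} N"
      by (metis set_mset_mset insert_DiffM)
    have "I \<subseteq> {0}"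
      using ps(2) ideal_prod_le(1)[OF ideal_zero, of "iprod N"] by (simp add: N)
    then show False
      using assms ideal_0 by blast
  qed
  then have "set_mset (mset ps) \<subseteq> primes"
    using ps(1) by (auto simp: primes_def)
  then have "factors I = mset ps"
    using factors_iprod ps(2) by blast
  then show "n = count (factors I) P"
    using ps(3) by (simp add: count_mset)
qed

section \<open>Units modulo an ideal and approximation at finitely many primes\<close>

lemma unit_mod_iff:
  assumes "ideal I \<D>" "I \<noteq> {0}"
  shows "(\<exists>y. x * y - 1 \<in> I) \<longleftrightarrow> (\<forall>P\<in>#factors I. x \<notin> P)"
proof
  assume "\<exists>y. x * y - 1 \<in> I"
  then obtain y where y: "x * y - 1 \<in> I"
    by blast
  show "\<forall>P\<in>#factors I. x \<notin> P"
  proof safe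
    fix P assume P: "P \<in># factors I" "x \<in> P"
    then have P': "P \<in> primes" "I \<subseteq> P"
      using in_factors_iff[OF assms] by auto
    then have "x * y - (x * y - 1) \<in> P"
      using ideal_diff[OF primesD(2)[OF P'(1)]] ideal_mult_right[OF primesD(2)[OF P'(1)]] P(2) y by blast
    then show False
      using primesD(3)[OF P'(1)] by simp
  qed
next
  assume *: "\<forall>P\<in>#factors I. x \<notin> P"
  define J where "J = {u + v | u v. u \<in> I \<and> v \<in> range ((*) x)}"
  have J: "ideal J \<D>"
    unfolding J_def by (rule ideal_plus[OF assms(1) ideal_principal])
  have IJ: "I \<subseteq> J"
  proof
    fix u assume "u \<in> I"
    moreover have "u = u + x * 0" by simp
    ultimately show "u \<in> J" unfolding J_def by blast
  qed
  have xJ: "x \<in> J"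
  proof -
    have "x = 0 + x * 1" by simp
    then show ?thesis
      unfolding J_def using ideal_0[OF assms(1)] by blast
  qed
  \<comment> \<open>\<open>I + (x)\<close> cannot be proper: a prime above it would be a factor of
    \<open>I\<close> containing \<open>x\<close>.\<close>
  have "1 \<in> J"
  proof (rule ccontr)
    assume "1 \<notin> J"
    then obtain P where P: "primeideal P \<D>" "J \<subseteq> P"
      using exists_prime_above[OF J] by blast
    then have "P \<in> primes"
      using IJ assms ideal_0[OF assms(1)] by (auto simp: primes_def)
    then show False
      using * P IJ xJ in_factors_iff[OF assms] by blast
  qed
  then obtain u y where "1 = u + x * y" "u \<in> I"
    by (auto simp: J_def)
  then have "x * y - 1 = - u"
    by (simp add: algebra_simps)
  then show "\<exists>y. x * y - 1 \<in> I"
    using ideal_minus[OF assms(1) \<open>u \<in> I\<close>] by metis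
qed

lemma prime_prod_mem:
  assumes "P \<in> primes" "finite A" "prod f A \<in> P"
  shows "\<exists>i\<in>A. f i \<in> P"
  using assms(2,3)
proof (induction A rule: finite_induct)
  case (insert i A)
  then show ?case
    using primesD(5)[OF assms(1), of "f i" "prod f A"] by auto
qed (use primesD(3)[OF assms(1)] in auto)

text \<open>With such a \<open>t\<close>, exactly one of \<open>r\<close> and \<open>t\<close> lies
  in each prime of \<open>S\<close>, so \<open>r + t\<close> avoids all of them. In this form the
  semilocality of a quotient enters the matrix arguments.\<close>

lemma exists_complementary:
  assumes fin: "finite S" and S: "S \<subseteq> primes" and I: "ideal I \<D>"
    and nle: "\<And>P. P \<in> S \<Longrightarrow> r \<in> P \<Longrightarrow> \<not> I \<subseteq> P"
  obtains t where "t \<in> I" "\<And>P. P \<in> S \<Longrightarrow> t \<in> P \<longleftrightarrow> r \<notin> P"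
proof -
  define B where "B = {P \<in> S. r \<in> P}"
  have "\<exists>z. z \<in> P' \<and> z \<notin> P" if "P \<in> S" "P' \<in> S" "P' \<noteq> P" for P P'
    using that S prime_maximal[of P' P] primesD(1) by blast
  then obtain z where z: "\<And>P P'. P \<in> S \<Longrightarrow> P' \<in> S \<Longrightarrow> P' \<noteq> P \<Longrightarrow> z P P' \<in> P' \<and> z P P' \<notin> P"
    by metis
  obtain i where i: "\<And>P. P \<in> B \<Longrightarrow> i P \<in> I \<and> i P \<notin> P"
    using nle unfolding B_def by (metis (mono_tags, lifting) mem_Collect_eq subsetI)
  \<comment> \<open>\<open>t P\<close> lies in every prime of \<open>S\<close> except
    \<open>P\<close>. In the sum over \<open>B\<close> exactly one summand survives at a prime of
    \<open>B\<close>, and none at the other primes of \<open>S\<close>.\<close>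
  define t where "t P = i P * (\<Prod>P'\<in>S - {P}. z P P')" for P
  have t_in: "t P \<in> P'" if "P \<in> B" "P' \<in> S" "P' \<noteq> P" for P P'
  proof -
    have P': "ideal P' \<D>"
      using that S primesD(2) by auto
    have "(\<Prod>P'\<in>S - {P}. z P P') \<in> P'"
      by (rule ideal_prod_elem_mem[OF P', of _ P']) (use that fin z in \<open>auto simp: B_def\<close>)
    then show ?thesis
      unfolding t_def by (rule ideal_mult_left[OF P'])
  qed
  have t_notin: "t P \<notin> P" if "P \<in> B" for P
  proof
    assume "t P \<in> P"
    moreover have P: "P \<in> primes"
      using that S by (auto simp: B_def)
    ultimately have "(\<Prod>P'\<in>S - {P}. z P P') \<in> P"
      using primesD(5)[OF P] i[OF that] unfolding t_def by blast
    then show False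
      using prime_prod_mem[OF P, of "S - {P}" "z P"] fin z that by (auto simp: B_def)
  qed
  have fB: "finite B" "B \<subseteq> S"
    using fin by (auto simp: B_def)
  show ?thesis
  proof (rule that)
    show "sum t B \<in> I"
      by (rule ideal_sum_mem[OF I]) (simp add: t_def i ideal_mult_right[OF I])
    fix P assume P: "P \<in> S"
    then have idP: "ideal P \<D>"
      using S primesD(2) by auto
    show "sum t B \<in> P \<longleftrightarrow> r \<notin> P"
    proof (cases "P \<in> B")
      case True
      have "sum t (B - {P}) \<in> P"
        by (rule ideal_sum_mem[OF idP]) (use t_in P in auto)
      then have "sum t B \<notin> P"
        using t_notin[OF True] ideal_diff[OF idP, of "sum t B" "sum t (B - {P})"] fB True
        by (auto simp: sum.remove)
      then show ?thesis
        using True by (simp add: B_def)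
    next
      case False
      then have "sum t B \<in> P"
        by (intro ideal_sum_mem[OF idP]) (use t_in P in auto)
      then show ?thesis
        using False P by (simp add: B_def)
    qed
  qed
qed

end

section \<open>Matrices and congruences\<close>

definition mk2 :: "'a \<Rightarrow> 'a \<Rightarrow> 'a \<Rightarrow> 'a \<Rightarrow> 'a::comm_ring_1 ^ 2 ^ 2" where
  "mk2 a b c d = vector [vector [a, b], vector [c, d]]"

abbreviation L :: "'a::comm_ring_1 \<Rightarrow> 'a ^ 2 ^ 2" where
  "L r \<equiv> mk2 1 0 r 1"

lemma mk2_nth [simp]:
  "mk2 a b c d $ 1 $ 1 = a" "mk2 a b c d $ 1 $ 2 = b"
  "mk2 a b c d $ 2 $ 1 = c" "mk2 a b c d $ 2 $ 2 = d"
  by (simp_all add: mk2_def)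

lemma mk2_mult:
  "mk2 a b c d ** mk2 a' b' c' d' =
     mk2 (a * a' + b * c') (a * b' + b * d') (c * a' + d * c') (c * b' + d * d')"
  by (simp add: vec_eq_iff forall_2 matrix_matrix_mult_def sum_2)

lemma mk2_eta: "mk2 (A $ 1 $ 1) (A $ 1 $ 2) (A $ 2 $ 1) (A $ 2 $ 2) = A"
  by (simp add: vec_eq_iff forall_2)

lemma T_eq_mk2: "T r = mk2 1 r 0 1"
  by (simp add: T_def mk2_def)

lemma mat_1_eq_mk2: "mat 1 = mk2 1 0 0 1"
  by (simp add: vec_eq_iff forall_2 mat_def)

lemma mk2_in_SL2 [simp]: "mk2 a b c d \<in> carrier SL2 \<longleftrightarrow> a * d - b * c = 1"
  by (simp add: SL2_def det_2)

lemma mk2_SL2_cases: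
  assumes "A \<in> carrier SL2"
  obtains a b c d where "A = mk2 a b c d" "a * d - b * c = 1"
  using assms mk2_in_SL2 mk2_eta[of A] by metis

lemma mult_SL2 [simp]: "A \<otimes>\<^bsub>SL2\<^esub> B = A ** B"
  and one_SL2: "\<one>\<^bsub>SL2\<^esub> = mat 1"
  by (simp_all add: SL2_def)

lemma inv_SL2_mk2:
  assumes "a * d - b * c = 1"
  shows "inv\<^bsub>SL2\<^esub> (mk2 a b c d) = mk2 d (- b) (- c) a"
  by (rule group.inv_equality[OF group_SL2])
    (use assms in \<open>simp_all add: mk2_mult one_SL2 mat_1_eq_mk2 algebra_simps\<close>)

lemma inv_SL2_T: "inv\<^bsub>SL2\<^esub> (T r) = T (- r)"
  by (simp add: T_eq_mk2 inv_SL2_mk2)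

definition matrix_cong :: "'a::comm_ring_1 set \<Rightarrow> 'a ^ 2 ^ 2 \<Rightarrow> 'a ^ 2 ^ 2 \<Rightarrow> bool" where
  "matrix_cong I A B \<longleftrightarrow> (\<forall>i j. A $ i $ j - B $ i $ j \<in> I)"

lemma matrix_cong_mk2:
  "matrix_cong I (mk2 a b c d) (mk2 a' b' c' d') \<longleftrightarrow>
     a - a' \<in> I \<and> b - b' \<in> I \<and> c - c' \<in> I \<and> d - d' \<in> I"
  by (auto simp: matrix_cong_def forall_2)

lemma principal_congruence_subgroup_iff:
  "A \<in> principal_congruence_subgroup I \<longleftrightarrow> A \<in> carrier SL2 \<and> matrix_cong I A (mat 1)"
  by (simp add: principal_congruence_subgroup_def matrix_cong_def)

context
  fixes I :: "'a::comm_ring_1 set"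
  assumes I: "ideal I \<D>"
begin

lemma matrix_cong_refl: "matrix_cong I A A"
  using ideal_0[OF I] by (simp add: matrix_cong_def)

lemma matrix_cong_sym: "matrix_cong I A B \<Longrightarrow> matrix_cong I B A"
  unfolding matrix_cong_def using ideal_minus[OF I] by fastforce

lemma matrix_cong_trans:
  assumes "matrix_cong I A B" "matrix_cong I B C"
  shows "matrix_cong I A C"
  unfolding matrix_cong_def
proof (intro allI)
  fix i j
  have "(A $ i $ j - B $ i $ j) + (B $ i $ j - C $ i $ j) \<in> I"
    by (rule ideal_add[OF I]) (use assms in \<open>auto simp: matrix_cong_def\<close>)
  then show "A $ i $ j - C $ i $ j \<in> I"
    by simp
qed

lemma matrix_cong_mult:
  assumes "matrix_cong I A A'" "matrix_cong I B B'"
  shows "matrix_cong I (A ** B) (A' ** B')"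
proof -
  have *: "x * y - x' * y' \<in> I" if "x - x' \<in> I" "y - y' \<in> I" for x y x' y' :: 'a
  proof -
    have "x * y - x' * y' = (x - x') * y + x' * (y - y')"
      by (simp add: algebra_simps)
    then show ?thesis
      using that I by (simp add: ideal_add ideal_mult_left ideal_mult_right)
  qed
  have **: "x * y + z * w - (x' * y' + z' * w') \<in> I"
    if "x - x' \<in> I" "y - y' \<in> I" "z - z' \<in> I" "w - w' \<in> I" for x y x' y' z w z' w' :: 'a
    using ideal_add[OF I *[OF that(1,2)] *[OF that(3,4)]] by (simp add: algebra_simps)
  show ?thesis
    using assms unfolding matrix_cong_def
    by (simp add: matrix_matrix_mult_def sum_2 **)
qed

text \<open>The quotient of \<open>A\<close> by \<open>B\<close> lies in the principal congruence
  subgroup, so membership in \<open>N\<close> may be tested modulo \<open>I\<close>.\<close>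

lemma matrix_cong_mem:
  assumes N: "subgroup N SL2" "principal_congruence_subgroup I \<subseteq> N"
    and A: "A \<in> carrier SL2" and B: "B \<in> N" and cong: "matrix_cong I A B"
  shows "A \<in> N"
proof -
  interpret group "SL2 :: ('a ^ 2 ^ 2) monoid"
    by (rule group_SL2)
  have B': "B \<in> carrier SL2"
    using subgroup.mem_carrier[OF N(1) B] .
  have "matrix_cong I (A ** inv\<^bsub>SL2\<^esub> B) (B ** inv\<^bsub>SL2\<^esub> B)"
    by (rule matrix_cong_mult[OF cong matrix_cong_refl])
  moreover have "B ** inv\<^bsub>SL2\<^esub> B = mat 1"
    using r_inv[OF B'] by (simp add: one_SL2)
  moreover have "A ** inv\<^bsub>SL2\<^esub> B \<in> carrier SL2"
    using m_closed[OF A inv_closed[OF B']] by simp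
  ultimately have "A ** inv\<^bsub>SL2\<^esub> B \<in> N"
    using N(2) by (auto simp: principal_congruence_subgroup_iff)
  then have "(A \<otimes>\<^bsub>SL2\<^esub> inv\<^bsub>SL2\<^esub> B) \<otimes>\<^bsub>SL2\<^esub> B \<in> N"
    using subgroup.m_closed[OF N(1) _ B] by simp
  also have "(A \<otimes>\<^bsub>SL2\<^esub> inv\<^bsub>SL2\<^esub> B) \<otimes>\<^bsub>SL2\<^esub> B = A"
    using A B' by (simp only: m_assoc inv_closed l_inv r_one)
  finally show ?thesis .
qed

lemma matrix_cong_inv:
  assumes "matrix_cong I A B" "A \<in> carrier SL2" "B \<in> carrier SL2"
  shows "matrix_cong I (inv\<^bsub>SL2\<^esub> A) (inv\<^bsub>SL2\<^esub> B)"
  using assms(2,3)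
proof (elim mk2_SL2_cases)
  fix a b c d a' b' c' d'
  assume *: "A = mk2 a b c d" "a * d - b * c = 1" "B = mk2 a' b' c' d'" "a' * d' - b' * c' = 1"
  show ?thesis
    using assms(1) ideal_minus[OF I, of "b - b'"] ideal_minus[OF I, of "c - c'"]
    by (simp add: * inv_SL2_mk2 matrix_cong_mk2)
qed

lemma T_cong: "r - s \<in> I \<Longrightarrow> matrix_cong I (T r) (T s)"
  using ideal_0[OF I] by (simp add: T_eq_mk2 matrix_cong_mk2)

end

section \<open>The normal core\<close>

definition core :: "('a::comm_ring_1 ^ 2 ^ 2) set \<Rightarrow> ('a ^ 2 ^ 2) set" where
  "core H = {A \<in> carrier SL2. \<forall>g\<in>carrier SL2. g \<otimes>\<^bsub>SL2\<^esub> A \<otimes>\<^bsub>SL2\<^esub> inv\<^bsub>SL2\<^esub> g \<in> H}"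

context
  fixes H :: "('a::comm_ring_1 ^ 2 ^ 2) set"
  assumes H: "subgroup H SL2"
begin

interpretation group "SL2 :: ('a ^ 2 ^ 2) monoid"
  by (rule group_SL2)

lemma core_subset: "core H \<subseteq> H"
proof
  fix A assume "A \<in> core H"
  then have "A \<in> carrier SL2" "\<one>\<^bsub>SL2\<^esub> \<otimes>\<^bsub>SL2\<^esub> A \<otimes>\<^bsub>SL2\<^esub> inv\<^bsub>SL2\<^esub> \<one>\<^bsub>SL2\<^esub> \<in> H"
    unfolding core_def using one_closed by blast+
  then show "A \<in> H"
    by (simp del: mult_SL2)
qed

lemma core_conj:
  assumes A: "A \<in> core H" and g: "g \<in> carrier SL2"
  shows "g \<otimes>\<^bsub>SL2\<^esub> A \<otimes>\<^bsub>SL2\<^esub> inv\<^bsub>SL2\<^esub> g \<in> core H"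
  unfolding core_def
proof (intro CollectI conjI ballI)
  have A': "A \<in> carrier SL2"
    using A by (simp add: core_def)
  show "g \<otimes>\<^bsub>SL2\<^esub> A \<otimes>\<^bsub>SL2\<^esub> inv\<^bsub>SL2\<^esub> g \<in> carrier SL2"
    using A' g by (simp del: mult_SL2)
  fix h :: "'a ^ 2 ^ 2" assume h: "h \<in> carrier SL2"
  have "h \<otimes>\<^bsub>SL2\<^esub> (g \<otimes>\<^bsub>SL2\<^esub> A \<otimes>\<^bsub>SL2\<^esub> inv\<^bsub>SL2\<^esub> g) \<otimes>\<^bsub>SL2\<^esub> inv\<^bsub>SL2\<^esub> h =
      (h \<otimes>\<^bsub>SL2\<^esub> g) \<otimes>\<^bsub>SL2\<^esub> A \<otimes>\<^bsub>SL2\<^esub> inv\<^bsub>SL2\<^esub> (h \<otimes>\<^bsub>SL2\<^esub> g)"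
    using A' g h by (simp add: inv_mult_group m_assoc del: mult_SL2)
  also have "\<dots> \<in> H"
    using A m_closed[OF h g] by (simp add: core_def del: mult_SL2)
  finally show "h \<otimes>\<^bsub>SL2\<^esub> (g \<otimes>\<^bsub>SL2\<^esub> A \<otimes>\<^bsub>SL2\<^esub> inv\<^bsub>SL2\<^esub> g) \<otimes>\<^bsub>SL2\<^esub> inv\<^bsub>SL2\<^esub> h \<in> H" .
qed

lemma subgroup_core: "subgroup (core H) SL2"
proof (rule subgroupI)
  show "core H \<subseteq> carrier SL2"
    by (auto simp: core_def)
  have "\<one>\<^bsub>SL2\<^esub> \<in> core H"
    using subgroup.one_closed[OF H] by (simp add: core_def del: mult_SL2)
  then show "core H \<noteq> {}"
    by blast
next
  fix A assume "A \<in> core H"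
  then have A: "A \<in> carrier SL2" "\<And>g. g \<in> carrier SL2 \<Longrightarrow> g \<otimes>\<^bsub>SL2\<^esub> A \<otimes>\<^bsub>SL2\<^esub> inv\<^bsub>SL2\<^esub> g \<in> H"
    by (auto simp: core_def)
  show "inv\<^bsub>SL2\<^esub> A \<in> core H"
    unfolding core_def
  proof (intro CollectI conjI ballI)
    fix g :: "'a ^ 2 ^ 2" assume g: "g \<in> carrier SL2"
    have "g \<otimes>\<^bsub>SL2\<^esub> inv\<^bsub>SL2\<^esub> A \<otimes>\<^bsub>SL2\<^esub> inv\<^bsub>SL2\<^esub> g = inv\<^bsub>SL2\<^esub> (g \<otimes>\<^bsub>SL2\<^esub> A \<otimes>\<^bsub>SL2\<^esub> inv\<^bsub>SL2\<^esub> g)"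
      using A(1) g by (simp add: inv_mult_group m_assoc del: mult_SL2)
    then show "g \<otimes>\<^bsub>SL2\<^esub> inv\<^bsub>SL2\<^esub> A \<otimes>\<^bsub>SL2\<^esub> inv\<^bsub>SL2\<^esub> g \<in> H"
      using subgroup.m_inv_closed[OF H A(2)[OF g]] by (simp del: mult_SL2)
  qed (simp add: A(1))
next
  fix A B assume "A \<in> core H" "B \<in> core H"
  then have A: "A \<in> carrier SL2" "\<And>g. g \<in> carrier SL2 \<Longrightarrow> g \<otimes>\<^bsub>SL2\<^esub> A \<otimes>\<^bsub>SL2\<^esub> inv\<^bsub>SL2\<^esub> g \<in> H"
    and B: "B \<in> carrier SL2" "\<And>g. g \<in> carrier SL2 \<Longrightarrow> g \<otimes>\<^bsub>SL2\<^esub> B \<otimes>\<^bsub>SL2\<^esub> inv\<^bsub>SL2\<^esub> g \<in> H"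
    by (auto simp: core_def)
  show "A \<otimes>\<^bsub>SL2\<^esub> B \<in> core H"
    unfolding core_def
  proof (intro CollectI conjI ballI)
    fix g :: "'a ^ 2 ^ 2" assume g: "g \<in> carrier SL2"
    have "g \<otimes>\<^bsub>SL2\<^esub> (A \<otimes>\<^bsub>SL2\<^esub> B) \<otimes>\<^bsub>SL2\<^esub> inv\<^bsub>SL2\<^esub> g =
        (g \<otimes>\<^bsub>SL2\<^esub> A \<otimes>\<^bsub>SL2\<^esub> inv\<^bsub>SL2\<^esub> g) \<otimes>\<^bsub>SL2\<^esub> (g \<otimes>\<^bsub>SL2\<^esub> B \<otimes>\<^bsub>SL2\<^esub> inv\<^bsub>SL2\<^esub> g)"
      using A(1) B(1) g by (simp add: m_assoc inv_solve_left del: mult_SL2)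
    then show "g \<otimes>\<^bsub>SL2\<^esub> (A \<otimes>\<^bsub>SL2\<^esub> B) \<otimes>\<^bsub>SL2\<^esub> inv\<^bsub>SL2\<^esub> g \<in> H"
      using subgroup.m_closed[OF H A(2)[OF g] B(2)[OF g]] by (simp del: mult_SL2)
  qed (use A(1) B(1) in \<open>simp del: mult_SL2\<close>)
qed

lemma T_in_core_iff: "T r \<in> core H \<longleftrightarrow> r \<in> quasi_level H"
  using T_in_SL2 by (auto simp: core_def quasi_level_def quasi_amplitude_def simp del: mult_SL2)

lemma principal_congruence_subgroup_core:
  assumes I: "ideal I \<D>" and le: "principal_congruence_subgroup I \<subseteq> H"
  shows "principal_congruence_subgroup I \<subseteq> core H"
proof
  fix A assume "A \<in> principal_congruence_subgroup I"
  then have A: "A \<in> carrier SL2" "matrix_cong I A (mat 1)"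
    by (simp_all add: principal_congruence_subgroup_iff)
  have "g \<otimes>\<^bsub>SL2\<^esub> A \<otimes>\<^bsub>SL2\<^esub> inv\<^bsub>SL2\<^esub> g \<in> H" if g: "g \<in> carrier SL2" for g
  proof -
    have "matrix_cong I (g ** A ** inv\<^bsub>SL2\<^esub> g) (g ** mat 1 ** inv\<^bsub>SL2\<^esub> g)"
      by (intro matrix_cong_mult[OF I] A(2) matrix_cong_refl[OF I])
    moreover have "g ** mat 1 ** inv\<^bsub>SL2\<^esub> g = mat 1"
      using r_inv[OF g] by (simp add: one_SL2)
    moreover have "g \<otimes>\<^bsub>SL2\<^esub> A \<otimes>\<^bsub>SL2\<^esub> inv\<^bsub>SL2\<^esub> g \<in> carrier SL2"
      using A(1) g by (simp del: mult_SL2)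
    ultimately show ?thesis
      using le by (auto simp: principal_congruence_subgroup_iff)
  qed
  then show "A \<in> core H"
    using A(1) by (simp add: core_def)
qed

text \<open>Conjugation by the Weyl element \<open>mk2 0 (-1) 1 0\<close> exchanges upper and lower
  unipotent matrices, with a sign.\<close>

lemma L_in_core:
  assumes "r \<in> quasi_level H"
  shows "L (- r) \<in> core H"
proof -
  have "mk2 0 (-1) 1 0 \<otimes>\<^bsub>SL2\<^esub> T r \<otimes>\<^bsub>SL2\<^esub> inv\<^bsub>SL2\<^esub> (mk2 0 (-1) 1 0) \<in> core H"
    by (rule core_conj) (use assms T_in_core_iff in auto)
  then show ?thesis
    by (simp add: inv_SL2_mk2 T_eq_mk2 mk2_mult)
qed

lemma T_in_core_if_L:
  assumes "L r \<in> core H"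
  shows "T (- r) \<in> core H"
proof -
  have "mk2 0 (-1) 1 0 \<otimes>\<^bsub>SL2\<^esub> L r \<otimes>\<^bsub>SL2\<^esub> inv\<^bsub>SL2\<^esub> (mk2 0 (-1) 1 0) \<in> core H"
    by (rule core_conj) (use assms in auto)
  then show ?thesis
    by (simp add: inv_SL2_mk2 T_eq_mk2 mk2_mult)
qed

lemma quasi_level_0: "0 \<in> quasi_level H"
  and quasi_level_add: "x \<in> quasi_level H \<Longrightarrow> y \<in> quasi_level H \<Longrightarrow> x + y \<in> quasi_level H"
  and quasi_level_minus: "x \<in> quasi_level H \<Longrightarrow> - x \<in> quasi_level H"
  and quasi_level_diff: "x \<in> quasi_level H \<Longrightarrow> y \<in> quasi_level H \<Longrightarrow> x - y \<in> quasi_level H"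
proof -
  show "0 \<in> quasi_level H"
    and add: "\<And>x y. x \<in> quasi_level H \<Longrightarrow> y \<in> quasi_level H \<Longrightarrow> x + y \<in> quasi_level H"
    using quasi_amplitude_additive[OF H] by (auto simp: quasi_level_def)
  show minus: "- x \<in> quasi_level H" if "x \<in> quasi_level H" for x
    using subgroup.m_inv_closed[OF subgroup_core, of "T x"] that
    by (simp add: inv_SL2_T T_in_core_iff)
  show "x - y \<in> quasi_level H" if "x \<in> quasi_level H" "y \<in> quasi_level H" for x y
    using add[OF that(1) minus[OF that(2)]] by simp
qed

lemma level_ideal: "ideal (level H) \<D>"
  and level_subset: "level H \<subseteq> quasi_level H"
  and level_greatest: "ideal J \<D> \<Longrightarrow> J \<subseteq> quasi_level H \<Longrightarrow> J \<subseteq> level H"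
  using largest_ideal_in[of "quasi_level H", OF quasi_level_0 quasi_level_add]
  by (auto simp: level_def)

end

section \<open>Lifting and the congruence subgroup of the level\<close>

text \<open>As the corner \<open>a\<close> is a unit modulo \<open>I\<close>, elementary matrices of
  the core adjust both off-diagonal entries while fixing \<open>a\<close>; the last entry is then
  forced modulo \<open>I\<close> by the determinant.\<close>

lemma core_same_corner:
  fixes H :: "('a::comm_ring_1 ^ 2 ^ 2) set"
  assumes H: "subgroup H SL2" and I: "ideal I \<D>" "principal_congruence_subgroup I \<subseteq> H"
    and q: "ideal \<qq> \<D>" "\<qq> \<subseteq> quasi_level H"
    and core: "mk2 a b c d \<in> core H" and SL2: "mk2 a b' c' d' \<in> carrier SL2"
    and in_q: "b \<in> \<qq>" "c \<in> \<qq>" "b' \<in> \<qq>" "c' \<in> \<qq>" and u: "a * u - 1 \<in> I"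
  shows "mk2 a b' c' d' \<in> core H"
proof -
  \<comment> \<open>Since \<open>u\<close> inverts \<open>a\<close> modulo \<open>I\<close>, these
    parameters carry \<open>c\<close> to \<open>c'\<close> and \<open>b\<close> to \<open>b'\<close>
    modulo \<open>I\<close>.\<close>
  define s where "s = (c' - c) * u"
  define t where "t = u * (b' - b)"
  define B where "B = a * t + b"
  define C where "C = s * a + c"
  define E where "E = C * t + (s * b + d)"
  note core_mult = subgroup.m_closed[OF subgroup_core[OF H], simplified]
  have "- s \<in> \<qq>" "t \<in> \<qq>"
    unfolding s_def t_def using ideal_minus[OF q(1) ideal_mult_right[OF q(1)]] ideal_mult_left[OF q(1)]
      ideal_diff[OF q(1)] in_q by blast+
  then have "- s \<in> quasi_level H" "t \<in> quasi_level H"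
    using q(2) by blast+
  then have "L s \<in> core H" "T t \<in> core H"
    using L_in_core[OF H, of "- s"] T_in_core_iff[OF H] by auto
  then have "L s ** mk2 a b c d ** T t \<in> core H"
    using core by (intro core_mult)
  moreover have "L s ** mk2 a b c d ** T t = mk2 a B C E"
    by (simp add: T_eq_mk2 mk2_mult B_def C_def E_def add.commute)
  ultimately have W: "mk2 a B C E \<in> core H"
    by simp
  then have "mk2 a B C E \<in> carrier SL2"
    using subgroup.subset[OF subgroup_core[OF H]] by blast
  then have det: "a * E - B * C = 1" "a * d' - b' * c' = 1"
    using SL2 by simp_all
  have "b' - B = - ((a * u - 1) * (b' - b))"
    by (simp add: B_def t_def algebra_simps)
  then have B: "b' - B \<in> I"
    using u by (simp add: ideal_minus[OF I(1)] ideal_mult_right[OF I(1)])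
  have "c' - C = - ((a * u - 1) * (c' - c))"
    by (simp add: C_def s_def algebra_simps)
  then have C: "c' - C \<in> I"
    using u by (simp add: ideal_minus[OF I(1)] ideal_mult_right[OF I(1)])
  \<comment> \<open>Comparing the two determinants puts \<open>a * (d' - E)\<close> into
    \<open>I\<close>; multiplication by \<open>u\<close> then removes the factor
    \<open>a\<close>.\<close>
  have **: "(b' - B) * c' + B * (c' - C) = a * (d' - E)"
    using det by (simp add: algebra_simps)
  have *: "u * ((b' - B) * c' + B * (c' - C)) - (a * u - 1) * (d' - E) = d' - E"
    unfolding ** by (simp add: algebra_simps)
  have E: "d' - E \<in> I"
    by (subst *[symmetric]) (rule ideal_diff[OF I(1) ideal_mult_left[OF I(1) ideal_add[OF I(1)
          ideal_mult_right[OF I(1) B] ideal_mult_left[OF I(1) C]]] ideal_mult_right[OF I(1) u]])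
  show ?thesis
    by (rule matrix_cong_mem[OF I(1) subgroup_core[OF H] principal_congruence_subgroup_core[OF H I] SL2 W])
      (use B C E ideal_0[OF I(1)] in \<open>simp add: matrix_cong_mk2\<close>)
qed

text \<open>For \<open>a - 1\<close> in the level this is an element of the core with prescribed
  corner \<open>a\<close> and off-diagonal entries in the level, the starting point for
  \<open>core_same_corner\<close>.\<close>

lemma conj_T_by_L_minus_1:
  "L (- 1) ** T (a - 1) ** L 1 = mk2 a (a - 1) (1 - a) (2 - a :: 'a::comm_ring_1)"
  by (simp add: T_eq_mk2 mk2_mult algebra_simps)

lemma diag_lift:
  assumes "ideal I \<D>" "u * v - 1 \<in> (I :: 'a::comm_ring_1 set)"
  shows "\<exists>A\<in>carrier SL2. matrix_cong I A (mk2 u 0 0 v)"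
proof
  \<comment> \<open>With \<open>w = u * v - 1\<close> the determinant is
    \<open>(1 + w) * (1 - w) + w * w = 1\<close>, and all corrections to the diagonal matrix are
    multiples of \<open>w\<close>.\<close>
  let ?A = "mk2 (u * (2 - u * v)) (u * v - 1) (1 - u * v) v"
  show "?A \<in> carrier SL2"
    by (simp add: algebra_simps)
  have "u * (2 - u * v) - u = - (u * (u * v - 1))" "1 - u * v = - (u * v - 1)"
    by (simp_all add: algebra_simps)
  then have "u * (2 - u * v) - u \<in> I" "1 - u * v \<in> I"
    using ideal_minus[OF assms(1) ideal_mult_left[OF assms]] ideal_minus[OF assms] by metis+
  then show "matrix_cong I ?A (mk2 u 0 0 v)"
    using assms ideal_0[OF assms(1)] by (simp add: matrix_cong_mk2)
qed

context dedekind
begin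

text \<open>Choose \<open>t\<close> in exactly those prime factors of \<open>I\<close> that do not
  contain \<open>a\<close>. A factor containing \<open>a\<close> does not contain \<open>b\<close>,
  by the determinant, so precisely one of \<open>a\<close> and \<open>b * t\<close> lies in each
  factor. Such a \<open>t\<close> can be found in \<open>J\<close> because a prime containing
  \<open>a\<close> cannot contain \<open>J\<close>, which has \<open>a - 1\<close> as an
  element.\<close>

lemma exists_unit_mod:
  fixes I J :: "'a set"
  assumes I: "ideal I \<D>" "I \<noteq> {0}" and J: "ideal J \<D>" "a - 1 \<in> J" and det: "a * d - b * c - 1 \<in> I"
  obtains t u where "t \<in> J" "(a + b * t) * u - 1 \<in> I"
proof -
  define S where "S = set_mset (factors I)"
  have S: "finite S" "S \<subseteq> primes" "\<And>P. P \<in> S \<Longrightarrow> I \<subseteq> P"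
    using in_factors_iff[OF I] by (auto simp: S_def)
  have "\<not> J \<subseteq> P" if "P \<in> S" "a \<in> P" for P
  proof
    assume "J \<subseteq> P"
    then have "a - (a - 1) \<in> P"
      using J(2) that(2) S(2) that(1) by (meson ideal_diff primesD(2) subsetD)
    then show False
      using that S(2) primesD(3) by auto
  qed
  then obtain t where t: "t \<in> J" "\<And>P. P \<in> S \<Longrightarrow> t \<in> P \<longleftrightarrow> a \<notin> P"
    using exists_complementary[OF S(1,2) J(1), of a] by metis
  have "a + b * t \<notin> P" if P: "P \<in> S" for P
  proof
    assume at: "a + b * t \<in> P"
    have Pp: "P \<in> primes" and det_P: "a * d - b * c - 1 \<in> P"
      using S P det by auto
    note P' = primesD[OF Pp]
    note diff = ideal_diff[OF P'(2)] and mult = ideal_mult_left[OF P'(2)] ideal_mult_right[OF P'(2)]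
    show False
    proof (cases "a \<in> P")
      case True
      then have "a + b * t - a \<in> P"
        using at diff by blast
      then have "b \<in> P"
        using P'(5)[of b t] t(2)[OF P] True by simp
      then have "(a * d - b * c) - (a * d - b * c - 1) \<in> P"
        using diff[OF diff[OF mult(2)[OF True] mult(2)] det_P] by blast
      then show False
        using P'(3) by simp
    next
      case False
      then have "a + b * t - b * t \<in> P"
        using False at t(2)[OF P] by (intro diff mult) auto
      then show False
        using False by simp
    qed
  qed
  then have "\<exists>u. (a + b * t) * u - 1 \<in> I"
    unfolding unit_mod_iff[OF I] by (simp add: S_def)
  then show ?thesis
    using that t(1) by blast
qed

lemma principal_congruence_subgroup_subset:
  fixes H :: "('a ^ 2 ^ 2) set"
  assumes H: "subgroup H SL2" and congr: "congruence_subgroup H"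
    and q: "ideal \<qq> \<D>" "\<qq> \<noteq> {0}" "\<qq> \<subseteq> quasi_level H"
  shows "principal_congruence_subgroup \<qq> \<subseteq> H"
proof
  obtain I0 where I0: "ideal I0 \<D>" "I0 \<noteq> {0}" "principal_congruence_subgroup I0 \<subseteq> H"
    using congr by (auto simp: congruence_subgroup_def)
  \<comment> \<open>The product lies in both ideals and is non-zero.\<close>
  define I where "I = ideal_prod \<D> I0 \<qq>"
  have I: "ideal I \<D>" "I \<noteq> {0}"
    unfolding I_def using I0 q ideal_ideal_prod ideal_prod_eq_0 by blast+
  have "I \<subseteq> I0" "I \<subseteq> \<qq>"
    unfolding I_def by (rule ideal_prod_le; fact)+
  then have IH: "principal_congruence_subgroup I \<subseteq> H"
    by (auto simp: principal_congruence_subgroup_def intro!: subsetD[OF I0(3)] subsetD[OF \<open>I \<subseteq> I0\<close>])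
  note core_mult = subgroup.m_closed[OF subgroup_core[OF H], simplified]
  fix A assume A: "A \<in> principal_congruence_subgroup \<qq>"
  then have "A \<in> carrier SL2" "matrix_cong \<qq> A (mat 1)"
    by (simp_all add: principal_congruence_subgroup_iff)
  then obtain a b c d where abcd: "A = mk2 a b c d" "a * d - b * c = 1" "a - 1 \<in> \<qq>" "b \<in> \<qq>" "c \<in> \<qq>" "d - 1 \<in> \<qq>"
    by (elim mk2_SL2_cases) (auto simp: mat_1_eq_mk2 matrix_cong_mk2)
  \<comment> \<open>A column operation with parameter in \<open>\<qq>\<close> makes the corner a
    unit modulo \<open>I\<close>; \<open>L (- t)\<close> undoes it at the end.\<close>
  obtain t u where t: "t \<in> \<qq>" "(a + b * t) * u - 1 \<in> I"
    using exists_unit_mod[OF I q(1) abcd(3), of d b c] abcd(2) ideal_0[OF I(1)] by auto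
  define a' where "a' = a + b * t"
  have "a' - 1 = (a - 1) + b * t"
    by (simp add: a'_def)
  then have a': "a' - 1 \<in> \<qq>"
    using ideal_add[OF q(1) abcd(3) ideal_mult_right[OF q(1) abcd(4)]] by metis
  then have a'': "1 - a' \<in> \<qq>"
    using ideal_minus[OF q(1) a'] by simp
  have "L (- 1) \<otimes>\<^bsub>SL2\<^esub> T (a' - 1) \<otimes>\<^bsub>SL2\<^esub> inv\<^bsub>SL2\<^esub> (L (- 1)) \<in> core H"
    by (rule core_conj[OF H]) (use a' q T_in_core_iff[OF H] in auto)
  then have "mk2 a' (a' - 1) (1 - a') (2 - a') \<in> core H"
    by (simp add: inv_SL2_mk2 conj_T_by_L_minus_1)
  then have "mk2 a' b (c + d * t) d \<in> core H"
  proof (rule core_same_corner[OF H I(1) IH q(1,3)])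
    show "mk2 a' b (c + d * t) d \<in> carrier SL2"
      using abcd(2) by (simp add: a'_def algebra_simps)
    show "c + d * t \<in> \<qq>"
      by (rule ideal_add[OF q(1) abcd(5) ideal_mult_left[OF q(1) t(1)]])
  qed (use a' a'' abcd t in \<open>auto simp: a'_def\<close>)
  moreover have "L (- t) \<in> core H"
    using L_in_core[OF H] t(1) q(3) by auto
  ultimately have "mk2 a' b (c + d * t) d ** L (- t) \<in> core H"
    by (rule core_mult)
  also have "mk2 a' b (c + d * t) d ** L (- t) = A"
    by (simp add: abcd(1) a'_def mk2_mult algebra_simps)
  finally show "A \<in> H"
    using core_subset[OF H] by blast
qed

text \<open>After a column operation the corner is a unit modulo \<open>I\<close>, so modulo
  \<open>I\<close> the matrix decomposes into a lower unipotent, a diagonal and an upper unipotent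
  factor. The unipotent factors lift as they stand, the diagonal one by
  \<open>diag_lift\<close>.\<close>

lemma SL2_lift:
  assumes I: "ideal I \<D>" "I \<noteq> {0}" and det: "a * d - b * c - 1 \<in> (I :: 'a set)"
  shows "\<exists>A\<in>carrier SL2. matrix_cong I A (mk2 a b c d)"
proof -
  obtain t u where t: "(a + b * t) * u - 1 \<in> I"
    using exists_unit_mod[OF I ideal_UNIV _ det] by auto
  define a' where "a' = a + b * t"
  define c' where "c' = c + d * t"
  obtain M where M: "M \<in> carrier SL2" "matrix_cong I M (mk2 a' 0 0 u)"
    using diag_lift[OF I(1), of a' u] t by (auto simp: a'_def)
  define A where "A = L (c' * u) ** M ** T (u * b) ** L (- t)"
  note mult = monoid.m_closed[OF group.is_monoid[OF group_SL2], simplified]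
  have "A \<in> carrier SL2"
    unfolding A_def by (intro mult M(1) T_in_SL2) simp_all
  note cong_refl = matrix_cong_refl[OF I(1)] and cong_mult = matrix_cong_mult[OF I(1)]
  have au: "a' * u - 1 \<in> I"
    using t by (simp add: a'_def)
  have "matrix_cong I A (L (c' * u) ** mk2 a' 0 0 u ** T (u * b) ** L (- t))"
    unfolding A_def by (intro cong_mult cong_refl M(2))
  moreover have "matrix_cong I (L (c' * u) ** mk2 a' 0 0 u ** T (u * b) ** L (- t)) (mk2 a' b c' d ** L (- t))"
  proof (intro cong_mult cong_refl)
    have "a' * (u * b) - b = (a' * u - 1) * b" "c' * u * a' - c' = (a' * u - 1) * c'"
      by (simp_all add: algebra_simps)
    moreover have "c' * u * a' * (u * b) + u - d = u * b * c' * (a' * u - 1) - u * (a' * d - b * c' - 1) + d * (a' * u - 1)"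
      by (simp add: algebra_simps)
    moreover have "a' * d - b * c' - 1 \<in> I"
      using det by (simp add: a'_def c'_def algebra_simps)
    ultimately have "a' * (u * b) - b \<in> I" "c' * u * a' - c' \<in> I" "c' * u * a' * (u * b) + u - d \<in> I"
      using ideal_mult_right[OF I(1) au] ideal_mult_left[OF I(1) au] ideal_mult_left[OF I(1), of _ u]
        ideal_add[OF I(1)] ideal_diff[OF I(1)] by metis+
    then show "matrix_cong I (L (c' * u) ** mk2 a' 0 0 u ** T (u * b)) (mk2 a' b c' d)"
      using ideal_0[OF I(1)] by (simp add: T_eq_mk2 mk2_mult matrix_cong_mk2)
  qed
  moreover have "mk2 a' b c' d ** L (- t) = mk2 a b c d"
    by (simp add: mk2_mult a'_def c'_def)
  ultimately have "matrix_cong I A (mk2 a b c d)"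
    using matrix_cong_trans[OF I(1)] by metis
  then show ?thesis
    using \<open>A \<in> carrier SL2\<close> by blast
qed

end

section \<open>Cusp amplitudes\<close>

lemma
  fixes H :: "('a::comm_ring_1 ^ 2 ^ 2) set"
  assumes H: "subgroup H SL2" and g: "g \<in> carrier SL2"
  shows cusp_amplitude_ideal: "ideal (cusp_amplitude H g) \<D>"
    and cusp_amplitude_subset: "cusp_amplitude H g \<subseteq> quasi_amplitude H g"
    and cusp_amplitude_greatest:
      "\<And>J. ideal J \<D> \<Longrightarrow> J \<subseteq> quasi_amplitude H g \<Longrightarrow> J \<subseteq> cusp_amplitude H g"
  using largest_ideal_in[of "quasi_amplitude H g", OF quasi_amplitude_additive[OF H g]]
  by (auto simp: cusp_amplitude_def)

lemma cusp_amplitude_iff: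
  fixes H :: "('a::comm_ring_1 ^ 2 ^ 2) set"
  assumes H: "subgroup H SL2" and g: "g \<in> carrier SL2"
  shows "r \<in> cusp_amplitude H g \<longleftrightarrow> (\<forall>s. r * s \<in> quasi_amplitude H g)"
proof
  assume "r \<in> cusp_amplitude H g"
  then show "\<forall>s. r * s \<in> quasi_amplitude H g"
    using ideal_mult_right[OF cusp_amplitude_ideal[OF H g]] cusp_amplitude_subset[OF H g] by blast
next
  assume "\<forall>s. r * s \<in> quasi_amplitude H g"
  then have "range ((*) r) \<subseteq> cusp_amplitude H g"
    by (intro cusp_amplitude_greatest[OF H g ideal_principal]) auto
  then show "r \<in> cusp_amplitude H g"
    using range_eqI[of r "(*) r" 1] by auto
qed

lemma level_subset_cusp_amplitude:
  fixes H :: "('a::comm_ring_1 ^ 2 ^ 2) set"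
  assumes H: "subgroup H SL2" and g: "g \<in> carrier SL2"
  shows "level H \<subseteq> cusp_amplitude H g"
  using level_subset[OF H] g
  by (intro cusp_amplitude_greatest[OF H g level_ideal[OF H]]) (auto simp: quasi_level_def)

lemma matrix_cong_Int:
  assumes "matrix_cong I A B" "matrix_cong J A B" "I \<inter> J \<subseteq> K"
  shows "matrix_cong K A B"
  using assms by (auto simp: matrix_cong_def)

text \<open>Modulo \<open>m1 \<inter> m2\<close>, the conjugates of \<open>T b\<close> with \<open>b \<in> m2\<close> only depend on the conjugating matrix modulo \<open>m1\<close>.\<close>

lemma cusp_amplitude_local:
  fixes H :: "('a::comm_ring_1 ^ 2 ^ 2) set"
  assumes H: "subgroup H SL2" "principal_congruence_subgroup \<qq> \<subseteq> H" and q: "ideal \<qq> \<D>"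
    and m: "ideal m1 \<D>" "ideal m2 \<D>" "m1 \<inter> m2 \<subseteq> \<qq>"
    and g: "g \<in> carrier SL2" "h \<in> carrier SL2" "matrix_cong m1 g h"
    and r: "r \<in> m2" "r \<in> cusp_amplitude H h"
  shows "r \<in> cusp_amplitude H g"
  unfolding cusp_amplitude_iff[OF H(1) g(1)]
proof
  fix s
  interpret group "SL2 :: ('a ^ 2 ^ 2) monoid"
    by (rule group_SL2)
  have *: "matrix_cong m2 (k ** T (r * s) ** inv\<^bsub>SL2\<^esub> k) (mat 1)" if k: "k \<in> carrier SL2" for k
  proof -
    have "matrix_cong m2 (T (r * s)) (T 0)"
      by (rule T_cong[OF m(2)]) (simp add: ideal_mult_right[OF m(2) r(1)])
    then have "matrix_cong m2 (k ** T (r * s) ** inv\<^bsub>SL2\<^esub> k) (k ** T 0 ** inv\<^bsub>SL2\<^esub> k)"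
      by (intro matrix_cong_mult[OF m(2)] matrix_cong_refl[OF m(2)])
    moreover have "k ** T 0 ** inv\<^bsub>SL2\<^esub> k = mat 1"
      using r_inv[OF k] by (simp add: one_SL2 T_0)
    ultimately show ?thesis
      by simp
  qed
  have "matrix_cong m2 (g ** T (r * s) ** inv\<^bsub>SL2\<^esub> g) (h ** T (r * s) ** inv\<^bsub>SL2\<^esub> h)"
    using matrix_cong_trans[OF m(2) *[OF g(1)] matrix_cong_sym[OF m(2) *[OF g(2)]]] .
  moreover have "matrix_cong m1 (g ** T (r * s) ** inv\<^bsub>SL2\<^esub> g) (h ** T (r * s) ** inv\<^bsub>SL2\<^esub> h)"
    by (intro matrix_cong_mult[OF m(1)] matrix_cong_refl[OF m(1)] matrix_cong_inv[OF m(1)] g)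
  ultimately have "matrix_cong \<qq> (g ** T (r * s) ** inv\<^bsub>SL2\<^esub> g) (h ** T (r * s) ** inv\<^bsub>SL2\<^esub> h)"
    using m(3) by (metis matrix_cong_Int)
  moreover have "h ** T (r * s) ** inv\<^bsub>SL2\<^esub> h \<in> H"
    using r(2) unfolding cusp_amplitude_iff[OF H(1) g(2)] by (simp add: quasi_amplitude_def)
  moreover have "g \<otimes>\<^bsub>SL2\<^esub> T (r * s) \<otimes>\<^bsub>SL2\<^esub> inv\<^bsub>SL2\<^esub> g \<in> carrier SL2"
    using g(1) T_in_SL2[of "r * s"] by (simp del: mult_SL2)
  ultimately show "r * s \<in> quasi_amplitude H g"
    using matrix_cong_mem[OF q H] by (simp add: quasi_amplitude_def)
qed

context dedekind
begin

text \<open>A prime factor of \<open>\<qq>\<close> goes to \<open>m1\<close> if the exponent of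
  \<open>c1\<close> there is at most that of \<open>c2\<close>, and to \<open>m2\<close> otherwise;
  \<open>m1\<close> and \<open>m2\<close> are the corresponding parts of \<open>\<qq>\<close>. So
  \<open>c1\<close> is the locally larger ideal at the primes of \<open>m1\<close>, and
  \<open>c2\<close> at those of \<open>m2\<close>. The element \<open>e\<close> is 1 modulo
  \<open>m1\<close> and 0 modulo \<open>m2\<close>.\<close>

lemma coprime_split:
  fixes \<qq> c1 c2 :: "'a set"
  assumes q: "ideal \<qq> \<D>" "\<qq> \<noteq> {0}" and c: "ideal c1 \<D>" "ideal c2 \<D>" "\<qq> \<subseteq> c1" "\<qq> \<subseteq> c2"
  obtains m1 m2 e where "ideal m1 \<D>" "ideal m2 \<D>" "m1 \<inter> m2 \<subseteq> \<qq>" "\<qq> \<subseteq> m1" "\<qq> \<subseteq> m2" "e \<in> m2" "1 - e \<in> m1"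
    "c1 \<inter> m1 \<subseteq> c2" "c2 \<inter> m2 \<subseteq> c1"
proof -
  define Q where "Q = factors \<qq>"
  define C1 where "C1 = factors c1"
  define C2 where "C2 = factors c2"
  define M1 where "M1 = filter_mset (\<lambda>P. count C1 P \<le> count C2 P) Q"
  define M2 where "M2 = filter_mset (\<lambda>P. \<not> count C1 P \<le> count C2 P) Q"
  have nz: "c \<noteq> {0}" if "ideal c \<D>" "\<qq> \<subseteq> c" for c
    using that q ideal_0[OF q(1)] by blast
  have le_Q: "factors c \<subseteq># Q" if "ideal c \<D>" "\<qq> \<subseteq> c" for c
    using factors_subset_iff[OF q that(1) nz[OF that]] that(2) by (simp add: Q_def)
  have Q: "set_mset Q \<subseteq> primes" "iprod Q = \<qq>"
    using factors[OF q] by (auto simp: Q_def)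
  then have M: "set_mset M1 \<subseteq> primes" "set_mset M2 \<subseteq> primes"
    by (auto simp: M1_def M2_def)
  note m = ideal_iprod_primes[OF M(1)] ideal_iprod_primes[OF M(2)]
  have fm: "factors (iprod M1) = M1" "factors (iprod M2) = M2"
    using M by (auto intro: factors_iprod)
  have "M1 + M2 = Q"
    unfolding M1_def M2_def by (rule multiset_partition[symmetric])
  then have prod: "ideal_prod \<D> (iprod M1) (iprod M2) = \<qq>"
    using iprod_union[of M1 M2] M primesD(2) Q(2) by (simp add: subset_iff)
  define J where "J = {u + v | u v. u \<in> iprod M1 \<and> v \<in> iprod M2}"
  have J: "ideal J \<D>"
    unfolding J_def by (rule ideal_plus[OF m])
  have mJ: "iprod M1 \<subseteq> J" "iprod M2 \<subseteq> J"
  proof -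
    have "x + 0 \<in> J" if "x \<in> iprod M1" for x
      unfolding J_def using that ideal_0[OF m(2)] by blast
    moreover have "0 + x \<in> J" if "x \<in> iprod M2" for x
      unfolding J_def using that ideal_0[OF m(1)] by blast
    ultimately show "iprod M1 \<subseteq> J" "iprod M2 \<subseteq> J"
      by auto
  qed
  have "1 \<in> J"
  proof (rule ccontr)
    assume "1 \<notin> J"
    then obtain P where P: "primeideal P \<D>" "J \<subseteq> P"
      using exists_prime_above[OF J] by blast
    moreover have "P \<noteq> {0}"
      using P mJ iprod_nonzero[OF M(1)] ideal_0[OF m(1)] by blast
    ultimately have "P \<in> primes"
      by (simp add: primes_def)
    then have "P \<in># M1" "P \<in># M2"
      using iprod_subset_prime[OF M(1)] iprod_subset_prime[OF M(2)] P(2) mJ by auto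
    then show False
      by (simp add: M1_def M2_def)
  qed
  then obtain f e where fe: "1 = f + e" "f \<in> iprod M1" "e \<in> iprod M2"
    by (auto simp: J_def)
  have "1 - e = f"
    unfolding fe(1) by simp
  then have e: "e \<in> iprod M2" "1 - e \<in> iprod M1"
    using fe(2,3) by blast+
  have le_count: "count (factors c) P \<le> count (factors (c \<inter> m)) P" "count (factors m) P \<le> count (factors (c \<inter> m)) P"
    if "ideal c \<D>" "ideal m \<D>" "\<qq> \<subseteq> c" "\<qq> \<subseteq> m" for c m P
  proof -
    note * = factors_subset_iff[OF ideal_Int[OF that(1,2)] nz[OF ideal_Int[OF that(1,2)]]]
    show "count (factors c) P \<le> count (factors (c \<inter> m)) P"
      using *[OF _ that(1) nz[OF that(1,3)]] that by (auto intro: mset_subset_eq_count)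
    show "count (factors m) P \<le> count (factors (c \<inter> m)) P"
      using *[OF _ that(2) nz[OF that(2,4)]] that by (auto intro: mset_subset_eq_count)
  qed
  have qm: "\<qq> \<subseteq> iprod M1" "\<qq> \<subseteq> iprod M2"
    using ideal_prod_le(1)[OF m(1), of "iprod M2"] ideal_prod_le(2)[OF m(2), of "iprod M1"]
    by (simp_all add: prod)
  have c_le: "c \<inter> m \<subseteq> c'" if "ideal c \<D>" "ideal m \<D>" "ideal c' \<D>" "\<qq> \<subseteq> c" "\<qq> \<subseteq> m" "\<qq> \<subseteq> c'"
    "\<And>P. count (factors c') P \<le> max (count (factors c) P) (count (factors m) P)" for c m c'
  proof -
    have "factors c' \<subseteq># factors (c \<inter> m)"
      unfolding subseteq_mset_def using le_count[OF that(1,2,4,5)] that(7)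
      by (meson max.boundedI order_trans)
    then show ?thesis
      using factors_subset_iff[OF ideal_Int[OF that(1,2)] nz[OF ideal_Int[OF that(1,2)]] that(3) nz[OF that(3,6)]] that
      by auto
  qed
  have C_le: "count C1 P \<le> count Q P" "count C2 P \<le> count Q P" for P
    using le_Q c by (auto simp: C1_def C2_def intro: mset_subset_eq_count)
  show ?thesis
  proof (rule that[OF m _ qm e])
    show "iprod M1 \<inter> iprod M2 \<subseteq> \<qq>"
    proof
      fix x assume "x \<in> iprod M1 \<inter> iprod M2"
      \<comment> \<open>Splitting \<open>x\<close> as \<open>(1 - e) * x + x * e\<close> moves the
        intersection of the coprime ideals into their product.\<close>
      then have "(1 - e) * x + x * e \<in> ideal_prod \<D> (iprod M1) (iprod M2)"
        using e by (intro ideal_add[OF ideal_ideal_prod[OF m]] ideal_prod_mem) auto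
      then show "x \<in> \<qq>"
        by (simp add: prod algebra_simps)
    qed
    \<comment> \<open>At the primes of \<open>M1\<close> the ideal \<open>iprod M1\<close> has the
      full exponent of \<open>\<qq>\<close>, which bounds that of \<open>c2\<close>; elsewhere the
      exponent of \<open>c1\<close> is at least that of \<open>c2\<close>.\<close>
    show "c1 \<inter> iprod M1 \<subseteq> c2"
      by (rule c_le) (use c m qm C_le fm in \<open>auto simp: M1_def C1_def[symmetric] C2_def[symmetric] max_def\<close>)
    show "c2 \<inter> iprod M2 \<subseteq> c1"
      by (rule c_le) (use c m qm C_le fm in \<open>auto simp: M2_def C1_def[symmetric] C2_def[symmetric] max_def\<close>)
  qed
qed

text \<open>Gluing the entries by \<open>e\<close> produces a matrix with the right residues whose
  determinant is 1 only modulo \<open>\<qq>\<close>; \<open>SL2_lift\<close> replaces it by a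
  genuine element.\<close>

lemma SL2_chinese_remainder:
  fixes \<qq> m1 m2 :: "'a set"
  assumes q: "ideal \<qq> \<D>" "\<qq> \<noteq> {0}" and m: "ideal m1 \<D>" "ideal m2 \<D>" "m1 \<inter> m2 \<subseteq> \<qq>" "\<qq> \<subseteq> m1" "\<qq> \<subseteq> m2"
    and e: "e \<in> m2" "1 - e \<in> m1"
    and h: "h1 \<in> carrier SL2" "h2 \<in> carrier SL2"
  obtains g where "g \<in> carrier SL2" "matrix_cong m1 g h1" "matrix_cong m2 g h2"
proof -
  define f where "f x y = e * x + (1 - e) * y" for x y
  have f: "f x y - x \<in> m1" "f x y - y \<in> m2" for x y
  proof -
    have *: "f x y - x = (1 - e) * (y - x)" "f x y - y = e * (x - y)"
      by (simp_all add: f_def algebra_simps)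
    show "f x y - x \<in> m1" "f x y - y \<in> m2"
      unfolding * using ideal_mult_right m e by blast+
  qed
  obtain a b c d where h1: "h1 = mk2 a b c d" "a * d - b * c = 1"
    using h(1) by (rule mk2_SL2_cases)
  obtain a' b' c' d' where h2: "h2 = mk2 a' b' c' d'" "a' * d' - b' * c' = 1"
    using h(2) by (rule mk2_SL2_cases)
  have det: "x * w - y * z - (x' * w' - y' * z') \<in> I"
    if "ideal I \<D>" "x - x' \<in> I" "y - y' \<in> I" "z - z' \<in> I" "w - w' \<in> I" for I x y z w x' y' z' w'
  proof -
    have "x * w - y * z - (x' * w' - y' * z') =
        ((x - x') * w + x' * (w - w')) - ((y - y') * z + y' * (z - z'))"
      by (simp add: algebra_simps)
    also have "\<dots> \<in> I"
      by (intro ideal_diff[OF that(1)] ideal_add[OF that(1)]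
          ideal_mult_right[OF that(1) that(2)] ideal_mult_right[OF that(1) that(3)]
          ideal_mult_left[OF that(1) that(4)] ideal_mult_left[OF that(1) that(5)])
    finally show ?thesis .
  qed
  let ?g = "mk2 (f a a') (f b b') (f c c') (f d d')"
  have g: "matrix_cong m1 ?g h1" "matrix_cong m2 ?g h2"
    by (simp_all add: h1(1) h2(1) matrix_cong_mk2 f)
  have "f a a' * f d d' - f b b' * f c c' - 1 \<in> m1"
    using det[OF m(1) f(1) f(1) f(1) f(1), of a a' d d' b b' c c'] h1(2) by simp
  moreover have "f a a' * f d d' - f b b' * f c c' - 1 \<in> m2"
    using det[OF m(2) f(2) f(2) f(2) f(2), of a a' d d' b b' c c'] h2(2) by simp
  ultimately have "f a a' * f d d' - f b b' * f c c' - 1 \<in> \<qq>"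
    using m(3) by blast
  then obtain A where A: "A \<in> carrier SL2" "matrix_cong \<qq> A ?g"
    using SL2_lift[OF q] by blast
  then have "matrix_cong m1 A ?g" "matrix_cong m2 A ?g"
    using m(4,5) by (auto simp: matrix_cong_def)
  then show ?thesis
    using that[OF A(1)] g matrix_cong_trans m(1,2) by blast
qed

end

section \<open>Congruence subgroups of a given level\<close>

locale congruence_level = dedekind ty for ty :: "'a::idom itself" +
  fixes H :: "('a ^ 2 ^ 2) set" and \<qq> :: "'a set"
  assumes q: "ideal \<qq> \<D>" "\<qq> \<noteq> {0}" and H: "subgroup H SL2" and level: "level H = \<qq>"
    and congruence: "congruence_subgroup H"
begin

lemma q_le_quasi_level: "\<qq> \<subseteq> quasi_level H"
  using level_subset[OF H] level by simp

lemma level_congruence_subset: "principal_congruence_subgroup \<qq> \<subseteq> H"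
  using principal_congruence_subgroup_subset[OF H congruence q q_le_quasi_level] .

lemma q_le_cusp: "g \<in> carrier SL2 \<Longrightarrow> \<qq> \<subseteq> cusp_amplitude H g"
  using level_subset_cusp_amplitude[OF H] level by simp

lemma cusp_nonzero: "g \<in> carrier SL2 \<Longrightarrow> cusp_amplitude H g \<noteq> {0}"
  using q_le_cusp q ideal_0[OF q(1)] by blast

text \<open>Gluing \<open>g1\<close> and \<open>g2\<close> along the splitting of
  \<open>coprime_split\<close> selects at every prime the locally larger of the two amplitudes;
  exchanging their roles selects the smaller one.\<close>

lemma cusp_amplitude_directed:
  assumes g: "g1 \<in> carrier SL2" "g2 \<in> carrier SL2"
  shows "\<exists>g\<in>carrier SL2. cusp_amplitude H g1 \<union> cusp_amplitude H g2 \<subseteq> cusp_amplitude H g"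
    and "\<exists>g\<in>carrier SL2. cusp_amplitude H g \<subseteq> cusp_amplitude H g1 \<inter> cusp_amplitude H g2"
proof -
  define c1 where "c1 = cusp_amplitude H g1"
  define c2 where "c2 = cusp_amplitude H g2"
  note id = cusp_amplitude_ideal[OF H]
  have c: "ideal c1 \<D>" "ideal c2 \<D>" "\<qq> \<subseteq> c1" "\<qq> \<subseteq> c2"
    using g id q_le_cusp by (auto simp: c1_def c2_def)
  obtain m1 m2 e where m: "ideal m1 \<D>" "ideal m2 \<D>" "m1 \<inter> m2 \<subseteq> \<qq>" "\<qq> \<subseteq> m1" "\<qq> \<subseteq> m2"
    and e: "e \<in> m2" "1 - e \<in> m1" and cm: "c1 \<inter> m1 \<subseteq> c2" "c2 \<inter> m2 \<subseteq> c1"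
    using coprime_split[OF q c] by metis
  note crt = SL2_chinese_remainder[OF q m e]
  note loc = cusp_amplitude_local[OF H level_congruence_subset q(1)]
  have m': "m2 \<inter> m1 \<subseteq> \<qq>"
    using m(3) by blast
  \<comment> \<open>\<open>r * e\<close> lies in \<open>m2\<close> and \<open>r * (1 - e)\<close> in
    \<open>m1\<close>, so each part is governed by the conjugating matrix modulo the other
    ideal.\<close>
  have split: "r \<in> I" if "ideal I \<D>" "r * e \<in> I" "r * (1 - e) \<in> I" for r I
    using ideal_add[OF that] by (simp add: algebra_simps)
  have me: "r * e \<in> m2" "r * (1 - e) \<in> m1" for r
    using ideal_mult_left m e by blast+
  show "\<exists>g\<in>carrier SL2. c1 \<union> c2 \<subseteq> cusp_amplitude H g"
  proof -
    obtain g where g': "g \<in> carrier SL2" "matrix_cong m1 g g1" "matrix_cong m2 g g2"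
      using crt[OF g] by blast
    have A: "r \<in> cusp_amplitude H g" if "r \<in> m2" "r \<in> c1" for r
      using loc[OF m(1,2,3) g'(1) g(1) g'(2) that(1)] that(2) by (simp add: c1_def)
    have B: "r \<in> cusp_amplitude H g" if "r \<in> m1" "r \<in> c2" for r
      using loc[OF m(2,1) m' g'(1) g(2) g'(3) that(1)] that(2) by (simp add: c2_def)
    have "r \<in> cusp_amplitude H g" if "r \<in> c1 \<or> r \<in> c2" for r
    proof (rule split[OF id[OF g'(1)]])
      have "r * e \<in> c1 \<or> r * e \<in> c2 \<inter> m2" "r * (1 - e) \<in> c2 \<or> r * (1 - e) \<in> c1 \<inter> m1"
        using that ideal_mult_right c me by blast+
      then show "r * e \<in> cusp_amplitude H g" "r * (1 - e) \<in> cusp_amplitude H g"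
        using A B me cm by blast+
    qed
    then show ?thesis
      using g'(1) by blast
  qed
  show "\<exists>g\<in>carrier SL2. cusp_amplitude H g \<subseteq> c1 \<inter> c2"
  proof -
    obtain g where g': "g \<in> carrier SL2" "matrix_cong m1 g g2" "matrix_cong m2 g g1"
      using crt[OF g(2,1)] by blast
    have A: "r \<in> c2" if "r \<in> m2" "r \<in> cusp_amplitude H g" for r
      using loc[OF m(1,2,3) g(2) g'(1) matrix_cong_sym[OF m(1) g'(2)] that] by (simp add: c2_def)
    have B: "r \<in> c1" if "r \<in> m1" "r \<in> cusp_amplitude H g" for r
      using loc[OF m(2,1) m' g(1) g'(1) matrix_cong_sym[OF m(2) g'(3)] that] by (simp add: c1_def)
    have "r \<in> c1 \<inter> c2" if r: "r \<in> cusp_amplitude H g" for r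
    proof (rule split[OF ideal_Int[OF c(1,2)]])
      have "r * e \<in> c2" "r * (1 - e) \<in> c1"
        using A B me ideal_mult_right[OF id[OF g'(1)] r] by blast+
      then show "r * e \<in> c1 \<inter> c2" "r * (1 - e) \<in> c1 \<inter> c2"
        using cm me by blast+
    qed
    then show ?thesis
      using g'(1) by blast
  qed
qed

text \<open>A strictly larger ideal has strictly fewer prime factors, so their number detects
  equality.\<close>

lemma cusp_eqI:
  assumes "g \<in> carrier SL2" "h \<in> carrier SL2" "cusp_amplitude H g \<subseteq> cusp_amplitude H h"
    and "size (factors (cusp_amplitude H g)) \<le> size (factors (cusp_amplitude H h))"
  shows "cusp_amplitude H g = cusp_amplitude H h"
proof -
  note g = cusp_amplitude_ideal[OF H assms(1)] cusp_nonzero[OF assms(1)]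
    and h = cusp_amplitude_ideal[OF H assms(2)] cusp_nonzero[OF assms(2)]
  have "factors (cusp_amplitude H h) \<subseteq># factors (cusp_amplitude H g)"
    using factors_subset_iff[OF g h] assms(3) by simp
  then have "factors (cusp_amplitude H h) = factors (cusp_amplitude H g)"
    using assms(4) mset_subset_size[of "factors (cusp_amplitude H h)" "factors (cusp_amplitude H g)"]
    by (metis linorder_not_less subset_mset.le_less)
  then show ?thesis
    using factors(2)[OF g] factors(2)[OF h] by simp
qed

text \<open>An amplitude with the fewest prime factors is maximal, and directedness turns maximal
  into largest.\<close>

lemma exists_largest_cusp_amplitude:
  "\<exists>g\<in>carrier SL2. \<forall>h\<in>carrier SL2. cusp_amplitude H h \<subseteq> cusp_amplitude H g"
proof -
  let ?s = "\<lambda>g. size (factors (cusp_amplitude H g))"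
  obtain g where g: "g \<in> carrier SL2" "\<And>h. h \<in> carrier SL2 \<Longrightarrow> ?s g \<le> ?s h"
    using ex_has_least_nat[of "\<lambda>g. g \<in> carrier SL2" "T 0" ?s] T_in_SL2 by blast
  have "cusp_amplitude H h \<subseteq> cusp_amplitude H g" if h: "h \<in> carrier SL2" for h
  proof -
    obtain k where k: "k \<in> carrier SL2" "cusp_amplitude H g \<union> cusp_amplitude H h \<subseteq> cusp_amplitude H k"
      using cusp_amplitude_directed(1)[OF g(1) h] by blast
    then have "cusp_amplitude H g = cusp_amplitude H k"
      by (intro cusp_eqI g) auto
    then show ?thesis
      using k by blast
  qed
  then show ?thesis
    using g(1) by blast
qed

text \<open>The number of prime factors is bounded by that of \<open>\<qq>\<close>, so it attains a
  greatest value; the amplitude there is minimal, hence smallest by directedness.\<close>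

lemma exists_smallest_cusp_amplitude:
  "\<exists>g\<in>carrier SL2. \<forall>h\<in>carrier SL2. cusp_amplitude H g \<subseteq> cusp_amplitude H h"
proof -
  let ?s = "\<lambda>g. size (factors (cusp_amplitude H g))"
  have "?s g \<le> size (factors \<qq>)" if "g \<in> carrier SL2" for g
    using that factors_subset_iff[OF q cusp_amplitude_ideal[OF H that] cusp_nonzero[OF that]] q_le_cusp
    by (simp add: size_mset_mono)
  then obtain g where g: "g \<in> carrier SL2" "\<And>h. h \<in> carrier SL2 \<Longrightarrow> ?s h \<le> ?s g"
    using ex_has_greatest_nat[of "\<lambda>g. g \<in> carrier SL2" "T 0" ?s "Suc (size (factors \<qq>))"] T_in_SL2
    by (metis less_Suc_eq_le)
  have "cusp_amplitude H g \<subseteq> cusp_amplitude H h" if h: "h \<in> carrier SL2" for h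
  proof -
    obtain k where k: "k \<in> carrier SL2" "cusp_amplitude H k \<subseteq> cusp_amplitude H g \<inter> cusp_amplitude H h"
      using cusp_amplitude_directed(2)[OF g(1) h] by blast
    then have "cusp_amplitude H k = cusp_amplitude H g"
      by (intro cusp_eqI g) auto
    then show ?thesis
      using k by blast
  qed
  then show ?thesis
    using g(1) by blast
qed

lemma Idl_cusp_amplitudes: "Idl\<^bsub>\<D>\<^esub> (\<Union>(cusp_amplitudes H)) \<in> cusp_amplitudes H"
proof -
  obtain g where g: "g \<in> carrier SL2" "\<And>h. h \<in> carrier SL2 \<Longrightarrow> cusp_amplitude H h \<subseteq> cusp_amplitude H g"
    using exists_largest_cusp_amplitude by blast
  then have "\<Union>(cusp_amplitudes H) = cusp_amplitude H g"
    by (auto simp: cusp_amplitudes_def)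
  moreover have "Idl\<^bsub>\<D>\<^esub> (cusp_amplitude H g) = cusp_amplitude H g"
    using cusp_amplitude_ideal[OF H g(1)] by (auto simp: genideal_def)
  ultimately show ?thesis
    using g(1) by (auto simp: cusp_amplitudes_def)
qed

text \<open>The smallest cusp amplitude is an ideal inside every quasi-amplitude, thus inside the
  quasi-level and so inside the level. Conversely the level lies in every cusp amplitude.\<close>

lemma Inter_cusp_amplitudes:
  shows "\<Inter>(cusp_amplitudes H) = \<qq>" "\<qq> \<in> cusp_amplitudes H"
proof -
  obtain g where g: "g \<in> carrier SL2" "\<And>h. h \<in> carrier SL2 \<Longrightarrow> cusp_amplitude H g \<subseteq> cusp_amplitude H h"
    using exists_smallest_cusp_amplitude by blast
  then have *: "\<Inter>(cusp_amplitudes H) = cusp_amplitude H g"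
    by (auto simp: cusp_amplitudes_def)
  have "cusp_amplitude H g \<subseteq> quasi_level H"
    using g(2) cusp_amplitude_subset[OF H] by (fastforce simp: quasi_level_def)
  then have "cusp_amplitude H g \<subseteq> \<qq>"
    using level_greatest[OF H cusp_amplitude_ideal[OF H g(1)]] level by simp
  then have "cusp_amplitude H g = \<qq>"
    using q_le_cusp[OF g(1)] by blast
  then show "\<Inter>(cusp_amplitudes H) = \<qq>" "\<qq> \<in> cusp_amplitudes H"
    using * g(1) by (auto simp: cusp_amplitudes_def)
qed

lemma T_mem_quasi_level:
  assumes "A \<in> core H" "matrix_cong \<qq> (T r) A"
  shows "r \<in> quasi_level H"
  using matrix_cong_mem[OF q(1) subgroup_core[OF H] principal_congruence_subgroup_core[OF H q(1) level_congruence_subset]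
      T_in_SL2 assms] T_in_core_iff[OF H] by blast

text \<open>Conjugation by the diagonal matrix with entries \<open>\<alpha>\<close> and
  \<open>\<beta>\<close> scales the entry of \<open>T r\<close> by the square of
  \<open>\<alpha>\<close>. This matrix has determinant 1 only modulo \<open>\<qq>\<close>; a lift is
  used, and the core absorbs the difference because it contains the principal congruence
  subgroup.\<close>

lemma square_mult_quasi_level:
  assumes unit: "\<alpha> * \<beta> - 1 \<in> \<qq>" and r: "r \<in> quasi_level H"
  shows "\<alpha>\<^sup>2 * r \<in> quasi_level H"
proof -
  obtain A where A: "A \<in> carrier SL2" "matrix_cong \<qq> A (mk2 \<alpha> 0 0 \<beta>)"
    using diag_lift[OF q(1) unit] by blast
  then obtain a b c d where abcd: "A = mk2 a b c d" "a * d - b * c = 1"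
    by (elim mk2_SL2_cases)
  have "matrix_cong \<qq> (inv\<^bsub>SL2\<^esub> A) (mk2 \<beta> 0 0 \<alpha>)"
    using A(2) ideal_minus[OF q(1), of b] ideal_minus[OF q(1), of c]
    by (simp add: abcd inv_SL2_mk2 matrix_cong_mk2)
  then have "matrix_cong \<qq> (A ** T r ** inv\<^bsub>SL2\<^esub> A) (mk2 \<alpha> 0 0 \<beta> ** T r ** mk2 \<beta> 0 0 \<alpha>)"
    by (intro matrix_cong_mult[OF q(1)] matrix_cong_refl[OF q(1)] A(2))
  moreover have "matrix_cong \<qq> (mk2 \<alpha> 0 0 \<beta> ** T r ** mk2 \<beta> 0 0 \<alpha>) (T (\<alpha>\<^sup>2 * r))"
    using unit ideal_0[OF q(1)]
    by (simp add: T_eq_mk2 mk2_mult matrix_cong_mk2 power2_eq_square mult_ac)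
  ultimately have "matrix_cong \<qq> (T (\<alpha>\<^sup>2 * r)) (A ** T r ** inv\<^bsub>SL2\<^esub> A)"
    using matrix_cong_trans[OF q(1)] matrix_cong_sym[OF q(1)] by blast
  moreover have "A \<otimes>\<^bsub>SL2\<^esub> T r \<otimes>\<^bsub>SL2\<^esub> inv\<^bsub>SL2\<^esub> A \<in> core H"
    using core_conj[OF H _ A(1)] r T_in_core_iff[OF H] by blast
  ultimately show ?thesis
    using T_mem_quasi_level by simp
qed

end

section \<open>Quotients and finite index\<close>

lemma carrier_Quot:
  fixes I :: "'a::comm_ring_1 set"
  shows "carrier (\<D> Quot I) = range (\<lambda>a. {x. x - a \<in> I})"
proof -
  have "(\<Union>h\<in>I. {h + a}) = {x. x - a \<in> I}" for a
    by (force simp: algebra_simps)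
  then show ?thesis
    by (auto simp: FactRing_def A_RCOSETS_def' a_r_coset_def')
qed

lemma coset_eq_iff:
  fixes I :: "'a::comm_ring_1 set"
  assumes I: "ideal I \<D>"
  shows "{x. x - a \<in> I} = {x. x - b \<in> I} \<longleftrightarrow> a - b \<in> I"
proof
  assume "{x. x - a \<in> I} = {x. x - b \<in> I}"
  then have "a \<in> {x. x - b \<in> I}"
    using ideal_0[OF I] by (metis diff_self mem_Collect_eq)
  then show "a - b \<in> I"
    by simp
next
  assume ab: "a - b \<in> I"
  have "x - b \<in> I" if "x - a \<in> I" for x
    using ideal_add[OF I that ab] by simp
  moreover have "x - a \<in> I" if "x - b \<in> I" for x
    using ideal_diff[OF I that ab] by simp
  ultimately show "{x. x - a \<in> I} = {x. x - b \<in> I}"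
    by blast
qed

lemma card_range_eq:
  assumes "\<And>x y. f x = f y \<longleftrightarrow> g x = g y"
  shows "card (range f) = card (range g)"
proof (rule bij_betw_same_card)
  show "bij_betw (\<lambda>z. g (inv_into UNIV f z)) (range f) (range g)"
    unfolding bij_betw_def
  proof
    show "inj_on (\<lambda>z. g (inv_into UNIV f z)) (range f)"
    proof (rule inj_onI)
      fix u v assume *: "u \<in> range f" "v \<in> range f" "g (inv_into UNIV f u) = g (inv_into UNIV f v)"
      then have "f (inv_into UNIV f u) = f (inv_into UNIV f v)"
        by (simp only: assms)
      then show "u = v"
        using * by (simp add: f_inv_into_f)
    qed
    have "g (inv_into UNIV f (f x)) = g x" for x
      using assms[of "inv_into UNIV f (f x)" x] by (simp add: f_inv_into_f)
    then show "(\<lambda>z. g (inv_into UNIV f z)) ` range f = range g"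
      by (auto simp: image_iff)
  qed
qed

text \<open>\<open>h\<close> is a homomorphism on the additive group with kernel \<open>I\<close>;
  its image is as large as the quotient, and Lagrange applies.\<close>

lemma card_Quot_dvd_order:
  fixes I :: "'a::comm_ring_1 set"
  assumes K: "group K" and I: "ideal I \<D>"
    and h: "\<And>r. h r \<in> carrier K" "\<And>r s. h (r + s) = h r \<otimes>\<^bsub>K\<^esub> h s" "\<And>r. h r = \<one>\<^bsub>K\<^esub> \<longleftrightarrow> r \<in> I"
  shows "card (carrier (\<D> Quot I)) dvd Coset.order K"
proof -
  interpret K: group K by fact
  have h0: "h 0 = \<one>\<^bsub>K\<^esub>"
    using h(3) ideal_0[OF I] by simp
  have hm: "inv\<^bsub>K\<^esub> (h r) = h (- r)" for r
    by (rule K.inv_equality) (simp_all add: h(1) h0 flip: h(2))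
  have "subgroup (range h) K"
    by (rule K.subgroupI) (auto simp: h(1) hm simp flip: h(2))
  then have "card (range h) dvd Coset.order K"
    using K.lagrange by (metis dvd_triv_right)
  moreover have "h r = h s \<longleftrightarrow> r - s \<in> I" for r s
  proof -
    have "h (r - s) = h r \<otimes>\<^bsub>K\<^esub> inv\<^bsub>K\<^esub> (h s)"
      unfolding hm h(2)[symmetric] by simp
    then show ?thesis
      unfolding h(3)[symmetric] using h(1) K.inv_solve_right[of "\<one>\<^bsub>K\<^esub>" "h r" "h s"]
      by (simp add: eq_commute[of _ "\<one>\<^bsub>K\<^esub>"])
  qed
  then have "card (range h) = card (carrier (\<D> Quot I))"
    unfolding carrier_Quot by (intro card_range_eq) (simp add: coset_eq_iff[OF I])
  ultimately show ?thesis
    by simp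
qed

text \<open>Elements of \<open>Bij S\<close> are \<open>undefined\<close> outside \<open>S\<close>
  whereas permutations are the identity there; restriction translates between the two.\<close>

lemma order_BijGroup:
  assumes "finite S"
  shows "Coset.order (BijGroup S) = fact (card S)"
proof -
  have "bij_betw (\<lambda>p. restrict p S) {p. p permutes S} (Bij S)"
  proof (rule bij_betw_byWitness[where f' = "\<lambda>f x. if x \<in> S then f x else x"])
    show "(\<lambda>p. restrict p S) ` {p. p permutes S} \<subseteq> Bij S"
      using permutes_imp_bij by (auto simp: Bij_def)
    show "(\<lambda>f x. if x \<in> S then f x else x) ` Bij S \<subseteq> {p. p permutes S}"
      by (auto simp: Bij_def intro!: bij_imp_permutes cong: bij_betw_cong)
  qed (auto simp: fun_eq_iff permutes_not_in Bij_def extensional_def)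
  then show ?thesis
    using card_permutations[OF refl assms] bij_betw_same_card
    by (fastforce simp: Coset.order_def BijGroup_def)
qed

text \<open>The additive group acts on the right cosets of \<open>H\<close> through right
  multiplication by \<open>T r\<close>. All cosets are fixed iff \<open>T r\<close> lies in every
  conjugate of \<open>H\<close>, so the kernel of the action is the quasi-level.\<close>

lemma card_Quot_dvd_fact:
  fixes H :: "('a::comm_ring_1 ^ 2 ^ 2) set"
  assumes H: "subgroup H SL2" and fin: "finite (rcosets\<^bsub>SL2\<^esub> H)" and id: "ideal (quasi_level H) \<D>"
  shows "card (carrier (\<D> Quot quasi_level H)) dvd fact (card (rcosets\<^bsub>SL2\<^esub> H))"
proof -
  interpret group "SL2 :: ('a ^ 2 ^ 2) monoid"
    by (rule group_SL2)
  define R where "R = rcosets\<^bsub>SL2\<^esub> H"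
  define \<phi> where "\<phi> r = (\<lambda>C\<in>R. C #>\<^bsub>SL2\<^esub> T r)" for r :: 'a
  note Hc = subgroup.subset[OF H]
  have T_mult: "T r \<otimes>\<^bsub>SL2\<^esub> T s = T (r + s)" for r s :: 'a
    by (simp add: T_add)
  have act: "C #>\<^bsub>SL2\<^esub> T r #>\<^bsub>SL2\<^esub> T s = C #>\<^bsub>SL2\<^esub> T (r + s)" if "C \<in> R" for C r s
    using coset_mult_assoc[of C "T r" "T s"] rcosets_part_G[OF H] that T_in_SL2
    by (auto simp: R_def T_mult simp del: mult_SL2)
  have closed: "C #>\<^bsub>SL2\<^esub> T r \<in> R" if C: "C \<in> R" for C r
  proof -
    obtain x where x: "C = H #>\<^bsub>SL2\<^esub> x" "x \<in> carrier SL2"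
      using C by (auto simp: R_def RCOSETS_def)
    then show ?thesis
      using coset_mult_assoc[OF Hc x(2) T_in_SL2] rcosetsI[OF Hc m_closed[OF x(2) T_in_SL2]]
      by (simp add: R_def del: mult_SL2)
  qed
  have one: "C #>\<^bsub>SL2\<^esub> T 0 = C" if "C \<in> R" for C
    using coset_mult_one[of C] rcosets_part_G[OF H] that by (auto simp: R_def T_0 one_SL2)
  have Bij: "\<phi> r \<in> Bij R" for r
    unfolding Bij_def
  proof
    show "\<phi> r \<in> {f. bij_betw f R R}"
      unfolding mem_Collect_eq
      by (rule bij_betw_byWitness[where f' = "\<phi> (- r)"]) (auto simp: \<phi>_def closed act one)
  qed (simp add: \<phi>_def)
  have "card (carrier (\<D> Quot quasi_level H)) dvd Coset.order (BijGroup R)"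
  proof (rule card_Quot_dvd_order[OF group_BijGroup id])
    show "\<phi> r \<in> carrier (BijGroup R)" for r
      using Bij by (simp add: BijGroup_def)
    \<comment> \<open>A right action reverses composition, which is harmless because addition
      commutes.\<close>
    show "\<phi> (r + s) = \<phi> r \<otimes>\<^bsub>BijGroup R\<^esub> \<phi> s" for r s
      using Bij by (auto simp: BijGroup_def compose_def \<phi>_def closed act add.commute fun_eq_iff)
    show "\<phi> r = \<one>\<^bsub>BijGroup R\<^esub> \<longleftrightarrow> r \<in> quasi_level H" for r
    proof -
      have "\<phi> r = \<one>\<^bsub>BijGroup R\<^esub> \<longleftrightarrow> (\<forall>C\<in>R. C #>\<^bsub>SL2\<^esub> T r = C)"
        by (auto simp: BijGroup_def \<phi>_def fun_eq_iff restrict_def)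
      also have "\<dots> \<longleftrightarrow> (\<forall>x\<in>carrier SL2. H #>\<^bsub>SL2\<^esub> (x \<otimes>\<^bsub>SL2\<^esub> T r) = H #>\<^bsub>SL2\<^esub> x)"
        using coset_mult_assoc[OF Hc _ T_in_SL2] by (auto simp: R_def RCOSETS_def simp del: mult_SL2)
      also have "\<dots> \<longleftrightarrow> (\<forall>x\<in>carrier SL2. x \<otimes>\<^bsub>SL2\<^esub> T r \<otimes>\<^bsub>SL2\<^esub> inv\<^bsub>SL2\<^esub> x \<in> H)"
      proof (rule ball_cong[OF refl])
        fix x :: "'a ^ 2 ^ 2" assume x: "x \<in> carrier SL2"
        note xT = m_closed[OF x T_in_SL2[of r]]
        show "H #>\<^bsub>SL2\<^esub> (x \<otimes>\<^bsub>SL2\<^esub> T r) = H #>\<^bsub>SL2\<^esub> x \<longleftrightarrow> x \<otimes>\<^bsub>SL2\<^esub> T r \<otimes>\<^bsub>SL2\<^esub> inv\<^bsub>SL2\<^esub> x \<in> H"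
          using subgroup.rcos_module[OF H group_axioms x xT] repr_independence[OF _ x H]
            repr_independenceD[OF H xT] by metis
      qed
      also have "\<dots> \<longleftrightarrow> r \<in> quasi_level H"
        by (auto simp: quasi_level_def quasi_amplitude_def)
      finally show ?thesis .
    qed
  qed
  also have "Coset.order (BijGroup R) = fact (card R)"
    using order_BijGroup fin by (simp add: R_def)
  finally show ?thesis
    by (simp add: R_def)
qed

lemma quasi_amplitude_normal:
  fixes H :: "('a::comm_ring_1 ^ 2 ^ 2) set"
  assumes H: "H \<lhd> SL2" and g: "g \<in> carrier SL2"
  shows "r \<in> quasi_amplitude H g \<longleftrightarrow> T r \<in> H"
proof -
  interpret normal H "SL2 :: ('a ^ 2 ^ 2) monoid"
    by fact
  have "inv\<^bsub>SL2\<^esub> g \<otimes>\<^bsub>SL2\<^esub> (g \<otimes>\<^bsub>SL2\<^esub> T r \<otimes>\<^bsub>SL2\<^esub> inv\<^bsub>SL2\<^esub> g) \<otimes>\<^bsub>SL2\<^esub> g = T r"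
    using g T_in_SL2[of r] by (simp add: m_assoc inv_solve_left' del: mult_SL2)
  then show ?thesis
    using inv_op_closed1[OF g] inv_op_closed2[OF g]
    unfolding quasi_amplitude_def by (metis mem_Collect_eq)
qed

text \<open>For normal \<open>H\<close> the map from \<open>r\<close> to the coset of
  \<open>T r\<close> is a homomorphism into the quotient group whose kernel is the quasi-level, so
  the index itself replaces its factorial.\<close>

lemma card_Quot_dvd_index:
  fixes H :: "('a::comm_ring_1 ^ 2 ^ 2) set"
  assumes H: "H \<lhd> SL2" and id: "ideal (quasi_level H) \<D>"
  shows "card (carrier (\<D> Quot quasi_level H)) dvd card (rcosets\<^bsub>SL2\<^esub> H)"
proof -
  interpret normal H "SL2 :: ('a ^ 2 ^ 2) monoid"
    by fact
  have ql: "r \<in> quasi_level H \<longleftrightarrow> T r \<in> H" for r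
    using quasi_amplitude_normal[OF H] one_closed by (auto simp: quasi_level_def)
  have "card (carrier (\<D> Quot quasi_level H)) dvd Coset.order (SL2 Mod H)"
  proof (rule card_Quot_dvd_order[OF factorgroup_is_group id])
    show "H #>\<^bsub>SL2\<^esub> T r \<in> carrier (SL2 Mod H)" for r
      using rcosetsI[OF subset T_in_SL2] by (simp add: FactGroup_def)
    show "H #>\<^bsub>SL2\<^esub> T (r + s) = (H #>\<^bsub>SL2\<^esub> T r) \<otimes>\<^bsub>SL2 Mod H\<^esub> (H #>\<^bsub>SL2\<^esub> T s)" for r s
      using rcos_sum[OF T_in_SL2 T_in_SL2, of r s] by (simp add: FactGroup_def T_add)
    show "H #>\<^bsub>SL2\<^esub> T r = \<one>\<^bsub>SL2 Mod H\<^esub> \<longleftrightarrow> r \<in> quasi_level H" for r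
      unfolding ql using coset_join1[OF _ T_in_SL2 subgroup_axioms] coset_join2[OF T_in_SL2 subgroup_axioms]
      by (auto simp: FactGroup_def)
  qed
  then show ?thesis
    by (simp add: Coset.order_def FactGroup_def)
qed

section \<open>Condition L\<close>

text \<open>Otherwise 0, 1 and -1 would represent all classes, and they are distinct because 1 and 2
  are not in \<open>P\<close>. Infinite quotients are covered as well, since their
  \<open>card\<close> is 0.\<close>

lemma exists_not_0_1_minus_1:
  fixes P :: "'a::comm_ring_1 set"
  assumes P: "ideal P \<D>" "1 \<notin> P" "2 \<notin> P" and card: "card (carrier (\<D> Quot P)) \<noteq> 3"
  obtains a where "a \<notin> P" "a - 1 \<notin> P" "a + 1 \<notin> P"
proof -
  let ?c = "\<lambda>a. {x. x - a \<in> P}"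
  have "\<exists>a. a \<notin> P \<and> a - 1 \<notin> P \<and> a + 1 \<notin> P"
  proof (rule ccontr)
    assume "\<not> ?thesis"
    then have "?c a = ?c 0 \<or> ?c a = ?c 1 \<or> ?c a = ?c (- 1)" for a
      unfolding coset_eq_iff[OF P(1)] by auto
    then have "range ?c = {?c 0, ?c 1, ?c (- 1)}"
      by blast
    moreover have "?c 0 \<noteq> ?c 1" "?c 1 \<noteq> ?c (- 1)" "?c 0 \<noteq> ?c (- 1)"
      unfolding coset_eq_iff[OF P(1)] using P(2,3) ideal_minus[OF P(1), of "-1"] by auto
    ultimately have "card (range ?c) = 3"
      by (simp add: card_insert_if)
    then show False
      using card by (simp add: carrier_Quot)
  qed
  then show ?thesis
    using that by blast
qed

context congruence_level
begin

lemma quasi_level_unit_square: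
  assumes "\<And>P. P \<in># factors \<qq> \<Longrightarrow> u \<notin> P" "x \<in> quasi_level H"
  shows "u\<^sup>2 * x \<in> quasi_level H"
  using unit_mod_iff[OF q, of u] square_mult_quasi_level assms by blast

text \<open>The level contains every ideal inside the quasi-level, in particular the principal one
  of \<open>x\<close>. Each of the three arguments towards the equality of quasi-level and level
  ends here.\<close>

lemma in_q_if_multiples:
  assumes "\<And>r. r * x \<in> quasi_level H"
  shows "x \<in> \<qq>"
proof -
  have "range ((*) x) \<subseteq> \<qq>"
    using level_greatest[OF H ideal_principal, of x] assms level by (auto simp: mult.commute)
  then show ?thesis
    using range_eqI[of x "(*) x" 1] by auto
qed

lemma quasi_level_mult_4: "x \<in> quasi_level H \<Longrightarrow> 4 * x \<in> quasi_level H"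
  using quasi_level_add[OF H, of "x + x" "x + x"] quasi_level_add[OF H, of x x] by simp

lemma prime_factorsD:
  assumes "P \<in># factors \<qq>"
  shows "P \<in> primes" "\<qq> \<subseteq> P"
  using assms in_factors_iff[OF q] by auto

end

section \<open>Levels modulo which 2 is invertible\<close>

locale odd_congruence_level = congruence_level +
  assumes odd: "\<exists>h. 2 * h - 1 \<in> \<qq>"
begin

lemma two_cancel: "2 * x \<in> \<qq> \<Longrightarrow> x \<in> \<qq>"
proof -
  assume x: "2 * x \<in> \<qq>"
  obtain h where h: "2 * h - 1 \<in> \<qq>"
    using odd by blast
  have "h * (2 * x) - (2 * h - 1) * x = x"
    by (simp add: algebra_simps)
  then show "x \<in> \<qq>"
    using ideal_diff[OF q(1) ideal_mult_left[OF q(1) x, of h] ideal_mult_right[OF q(1) h, of x]] by simp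
qed

lemma four_cancel: "4 * x \<in> \<qq> \<Longrightarrow> x \<in> \<qq>"
  using two_cancel[of "2 * x"] two_cancel[of x] by simp

lemma two_notin: "P \<in># factors \<qq> \<Longrightarrow> 2 \<notin> P"
  using unit_mod_iff[OF q, of 2] odd by blast

text \<open>If \<open>u\<close> is a unit modulo \<open>\<qq>\<close>, so are \<open>u + s\<close>
  and \<open>u - s\<close>, and their squares differ by \<open>4 * u * s\<close>. Every
  \<open>2 * r\<close> is a sum of two units modulo \<open>\<qq>\<close>, which gives all multiples
  of \<open>8 * s * x\<close>.\<close>

lemma radical_mult_quasi_level:
  assumes s: "\<And>P. P \<in># factors \<qq> \<Longrightarrow> s \<in> P" and x: "x \<in> quasi_level H"
  shows "s * x \<in> \<qq>"
proof -
  have unit: "4 * (u * s * x) \<in> quasi_level H" if u: "\<And>P. P \<in># factors \<qq> \<Longrightarrow> u \<notin> P" for u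
  proof -
    have "u + s \<notin> P \<and> u - s \<notin> P" if P: "P \<in># factors \<qq>" for P
    proof -
      note idP = primesD(2)[OF prime_factorsD(1)[OF P]]
      show ?thesis
        using ideal_diff[OF idP _ s[OF P], of "u + s"] ideal_add[OF idP _ s[OF P], of "u - s"] u[OF P] by auto
    qed
    then have "(u + s)\<^sup>2 * x - (u - s)\<^sup>2 * x \<in> quasi_level H"
      by (intro quasi_level_diff[OF H] quasi_level_unit_square x) auto
    also have "(u + s)\<^sup>2 * x - (u - s)\<^sup>2 * x = 4 * (u * s * x)"
      by (simp add: power2_eq_square algebra_simps)
    finally show ?thesis .
  qed
  have "r * (4 * (2 * (s * x))) \<in> quasi_level H" for r
  proof -
    have fS: "finite (set_mset (factors \<qq>))" "set_mset (factors \<qq>) \<subseteq> primes"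
      using prime_factorsD(1) by auto
    have "\<not> UNIV \<subseteq> P" if "P \<in> set_mset (factors \<qq>)" "r \<in> P" for P
      using that primesD(3)[OF prime_factorsD(1)[of P]] by auto
    then obtain t where t: "\<And>P. P \<in># factors \<qq> \<Longrightarrow> t \<in> P \<longleftrightarrow> r \<notin> P"
      using exists_complementary[OF fS ideal_UNIV, of r] by metis
    \<comment> \<open>Exactly one of \<open>r\<close> and \<open>2 * t\<close> lies in each prime
      factor, as 2 lies in none; so the sum and the difference avoid all of them.\<close>
    have u: "r + 2 * t \<notin> P \<and> r - 2 * t \<notin> P" if P: "P \<in># factors \<qq>" for P
    proof -
      note P' = primesD[OF prime_factorsD(1)[OF P]]
      show ?thesis
      proof (cases "r \<in> P")
        case True
        then have "2 * t \<notin> P"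
          using P'(5) t[OF P] two_notin[OF P] by blast
        then show ?thesis
          using ideal_diff[OF P'(2) _ True, of "r + 2 * t"] ideal_diff[OF P'(2) True, of "r - 2 * t"] by auto
      next
        case False
        then have "2 * t \<in> P"
          using t[OF P] ideal_mult_left[OF P'(2)] by blast
        then show ?thesis
          using False ideal_diff[OF P'(2) _ \<open>2 * t \<in> P\<close>, of "r + 2 * t"]
            ideal_add[OF P'(2) _ \<open>2 * t \<in> P\<close>, of "r - 2 * t"] by auto
      qed
    qed
    have "4 * ((r + 2 * t) * s * x) + 4 * ((r - 2 * t) * s * x) \<in> quasi_level H"
      by (intro quasi_level_add[OF H] unit) (use u in auto)
    also have "4 * ((r + 2 * t) * s * x) + 4 * ((r - 2 * t) * s * x) = r * (4 * (2 * (s * x)))"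
      by (simp add: algebra_simps)
    finally show ?thesis .
  qed
  then show ?thesis
    using in_q_if_multiples four_cancel two_cancel by blast
qed

text \<open>The level is \<open>P\<close> times an ideal prime to \<open>P\<close>. A factor
  \<open>c\<close> in that second ideal but outside \<open>P\<close> makes multiples of
  \<open>c * x\<close> depend, modulo \<open>\<qq>\<close>, only on residues modulo
  \<open>P\<close>, where differences of squares reach every residue.\<close>

lemma quasi_level_subset_prime:
  assumes P: "P \<in># factors \<qq>" and count: "count (factors \<qq>) P = 1"
    and card: "card (carrier (\<D> Quot P)) \<noteq> 3" and x: "x \<in> quasi_level H"
  shows "x \<in> P"
proof -
  note P' = primesD[OF prime_factorsD(1)[OF P]]
  define M where "M = factors \<qq> - {#P#}"
  have Q: "factors \<qq> = add_mset P M"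
    using P by (simp add: M_def)
  then have M: "P \<notin># M"
    using count by (auto simp: not_in_iff)
  have Mp: "set_mset M \<subseteq> primes"
    using prime_factorsD(1) Q by auto
  note m = ideal_iprod_primes[OF Mp]
  have Pm: "ideal_prod \<D> P (iprod M) = \<qq>"
    using factors(2)[OF q] by (simp add: Q)
  have "\<not> iprod M \<subseteq> P"
    using iprod_subset_prime[OF Mp prime_factorsD(1)[OF P]] M by blast
  then obtain e0 where e0: "e0 \<in> iprod M" "e0 \<notin> P"
    by blast
  obtain y where "e0 * y - 1 \<in> P"
    using prime_inverse[OF prime_factorsD(1)[OF P] e0(2)] by blast
  then obtain e where e: "e \<in> iprod M" "e - 1 \<in> P"
    using ideal_mult_right[OF m e0(1)] by blast
  obtain \<alpha> where \<alpha>: "\<alpha> \<notin> P" "\<alpha> - 1 \<notin> P" "\<alpha> + 1 \<notin> P"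
    using exists_not_0_1_minus_1[OF P'(2,3) two_notin[OF P] card] by metis
  \<comment> \<open>\<open>f b\<close> is \<open>b\<close> modulo \<open>P\<close> and 1 modulo
    \<open>iprod M\<close>, hence a unit modulo \<open>\<qq>\<close> whenever \<open>b\<close> is
    not in \<open>P\<close>.\<close>
  define f where "f b = 1 + e * (b - 1)" for b
  have fP: "f b - b \<in> P" for b
  proof -
    have "f b - b = (e - 1) * (b - 1)"
      by (simp add: f_def algebra_simps)
    then show ?thesis
      using ideal_mult_right[OF P'(2) e(2)] by simp
  qed
  have fP': "b \<in> P" if "f b \<in> P" for b
    using ideal_diff[OF P'(2) that fP[of b]] by simp
  have f_unit: "f b \<notin> R" if "b \<notin> P" "R \<in># factors \<qq>" for b R
  proof (cases "R = P")
    case True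
    then show ?thesis
      using that fP' by blast
  next
    case False
    then have "R \<in># M"
      using that(2) Q by simp
    moreover have R: "R \<in> primes"
      using prime_factorsD(1)[OF that(2)] .
    ultimately have "iprod M \<subseteq> R"
      using iprod_subset_iff[OF Mp, of "{#R#}"] ideal_prod_UNIV[OF primesD(2)[OF R]] by simp
    then have "e * (b - 1) \<in> R"
      using e(1) ideal_mult_right[OF primesD(2)[OF R]] by blast
    then show ?thesis
      using ideal_diff[OF primesD(2)[OF R], of "f b" "e * (b - 1)"] primesD(3)[OF R] by (auto simp: f_def)
  qed
  \<comment> \<open>As a difference of two unit squares, \<open>c\<close> keeps \<open>c * x\<close>
    in the quasi-level; since \<open>\<alpha>\<close> is neither 1 nor -1 modulo \<open>P\<close>,
    \<open>c\<close> is outside \<open>P\<close>.\<close>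
  define c where "c = (f \<alpha>)\<^sup>2 - 1"
  have c_eq: "c = (f \<alpha> - 1) * (f \<alpha> + 1)"
    by (simp add: c_def power2_eq_square algebra_simps)
  have "f \<alpha> - 1 \<in> iprod M"
    using ideal_mult_right[OF m e(1)] by (simp add: f_def)
  then have cm: "c \<in> iprod M"
    unfolding c_eq by (rule ideal_mult_right[OF m])
  have "c \<notin> P"
  proof
    assume "c \<in> P"
    then have "f \<alpha> - 1 \<in> P \<or> f \<alpha> + 1 \<in> P"
      unfolding c_eq by (rule P'(5))
    then show False
      using ideal_diff[OF P'(2) _ fP[of \<alpha>], of "f \<alpha> - 1"] ideal_diff[OF P'(2) _ fP[of \<alpha>], of "f \<alpha> + 1"] \<alpha>
      by (auto simp: algebra_simps)
  qed
  have Pc: "p * c * x \<in> quasi_level H" if "p \<in> P" for p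
    using ideal_mult_right[OF q(1), of "p * c" x] ideal_prod_mem[OF that cm] Pm q_le_quasi_level by auto
  have "(f \<alpha>)\<^sup>2 * x - x \<in> quasi_level H"
    by (intro quasi_level_diff[OF H] quasi_level_unit_square x f_unit \<alpha>(1))
  then have cx: "c * x \<in> quasi_level H"
    by (simp add: c_def algebra_simps)
  \<comment> \<open>Replacing \<open>f b\<close> by \<open>b\<close> changes the square by an
    element of \<open>P\<close>, and the product of \<open>P\<close> with \<open>c\<close> lies in
    \<open>\<qq>\<close>.\<close>
  have sq: "b\<^sup>2 * (c * x) \<in> quasi_level H" if b: "b \<notin> P" for b
  proof -
    have "(f b - b) * (f b + b) \<in> P"
      by (rule ideal_mult_right[OF P'(2) fP])
    then have "(f b)\<^sup>2 * (c * x) - ((f b - b) * (f b + b)) * c * x \<in> quasi_level H"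
      by (intro quasi_level_diff[OF H] quasi_level_unit_square cx f_unit b Pc)
    also have "(f b)\<^sup>2 * (c * x) - ((f b - b) * (f b + b)) * c * x = b\<^sup>2 * (c * x)"
      by (simp add: power2_eq_square algebra_simps)
    finally show ?thesis .
  qed
  have "r * (4 * (c * x)) \<in> quasi_level H" for r
  proof -
    \<comment> \<open>Polarization requires \<open>r + 1\<close> and \<open>r - 1\<close> to be
      units at \<open>P\<close>; in the exceptional cases \<open>r\<close> is a sign plus an element
      of \<open>P\<close> and is treated directly.\<close>
    consider "r - 1 \<in> P" | "r + 1 \<in> P" | "r - 1 \<notin> P" "r + 1 \<notin> P"
      by blast
    then show ?thesis
    proof cases
      case 1
      then have "4 * (c * x + (r - 1) * c * x) \<in> quasi_level H"
        by (intro quasi_level_mult_4 quasi_level_add[OF H] cx Pc)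
      also have "4 * (c * x + (r - 1) * c * x) = r * (4 * (c * x))"
        by (simp add: algebra_simps)
      finally show ?thesis .
    next
      case 2
      then have "4 * ((r + 1) * c * x - c * x) \<in> quasi_level H"
        by (intro quasi_level_mult_4 quasi_level_diff[OF H] cx Pc)
      also have "4 * ((r + 1) * c * x - c * x) = r * (4 * (c * x))"
        by (simp add: algebra_simps)
      finally show ?thesis .
    next
      case 3
      then have "(r + 1)\<^sup>2 * (c * x) - (r - 1)\<^sup>2 * (c * x) \<in> quasi_level H"
        by (intro quasi_level_diff[OF H] sq)
      also have "(r + 1)\<^sup>2 * (c * x) - (r - 1)\<^sup>2 * (c * x) = r * (4 * (c * x))"
        by (simp add: power2_eq_square algebra_simps)
      finally show ?thesis .
    qed
  qed
  then have "c * x \<in> \<qq>"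
    using in_q_if_multiples four_cancel by blast
  then show ?thesis
    using P'(5)[of c x] \<open>c \<notin> P\<close> prime_factorsD(2)[OF P] by blast
qed

text \<open>With \<open>x * x\<close> in \<open>\<qq>\<close>, matrices of the form identity plus
  \<open>x\<close> times another matrix multiply, modulo \<open>\<qq>\<close>, by adding the other
  matrices. For \<open>c\<close> and \<open>- c\<close> the diagonal parts are opposite and cancel;
  \<open>T (- (x + x))\<close> clears the upper entry and leaves a lower unipotent matrix.\<close>

lemma square_zero_in_q:
  assumes x: "x \<in> quasi_level H" "x * x \<in> \<qq>"
  shows "x \<in> \<qq>"
proof -
  note core_mult = subgroup.m_closed[OF subgroup_core[OF H], simplified]
  have xx: "x * x * y \<in> \<qq>" for y
    by (rule ideal_mult_right[OF q(1) x(2)])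
  have conj: "mk2 (1 - x * c) x (- (x * c * c)) (1 + x * c) \<in> core H" for c
  proof -
    have "L c \<otimes>\<^bsub>SL2\<^esub> T x \<otimes>\<^bsub>SL2\<^esub> inv\<^bsub>SL2\<^esub> (L c) \<in> core H"
      by (rule core_conj[OF H]) (use x T_in_core_iff[OF H] in auto)
    then show ?thesis
      by (simp add: inv_SL2_mk2 T_eq_mk2 mk2_mult algebra_simps)
  qed
  have sq: "2 * c\<^sup>2 * x \<in> quasi_level H" for c
  proof -
    define B where "B = mk2 (1 - x * c) x (- (x * c * c)) (1 + x * c) **
      mk2 (1 + x * c) x (- (x * c * c)) (1 - x * c)"
    have "T (- (x + x)) \<in> core H"
      using quasi_level_minus[OF H quasi_level_add[OF H x(1) x(1)]] T_in_core_iff[OF H] by blast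
    then have core: "B ** T (- (x + x)) \<in> core H"
      unfolding B_def using conj[of c] conj[of "- c"] by (intro core_mult) simp_all
    have "matrix_cong \<qq> B (mk2 1 (x + x) (- (2 * c\<^sup>2 * x)) 1)"
    proof -
      have *: "B = mk2 (1 - x * x * (2 * c * c)) (x + x - x * x * (2 * c))
          (- (2 * c\<^sup>2 * x) - x * x * (2 * c * c * c)) (1 - x * x * (2 * c * c))"
        by (simp add: B_def mk2_mult power2_eq_square algebra_simps)
      show ?thesis
        unfolding * matrix_cong_mk2 using ideal_minus[OF q(1) xx] ideal_0[OF q(1)] by simp
    qed
    then have "matrix_cong \<qq> (B ** T (- (x + x))) (mk2 1 (x + x) (- (2 * c\<^sup>2 * x)) 1 ** T (- (x + x)))"
      by (intro matrix_cong_mult[OF q(1)] matrix_cong_refl[OF q(1)])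
    moreover have "matrix_cong \<qq> (mk2 1 (x + x) (- (2 * c\<^sup>2 * x)) 1 ** T (- (x + x))) (L (- (2 * c\<^sup>2 * x)))"
    proof -
      have *: "mk2 1 (x + x) (- (2 * c\<^sup>2 * x)) 1 ** T (- (x + x)) =
          mk2 1 0 (- (2 * c\<^sup>2 * x)) (1 + x * x * (4 * c * c))"
        by (simp add: T_eq_mk2 mk2_mult power2_eq_square algebra_simps)
      show ?thesis
        unfolding * matrix_cong_mk2 using xx ideal_0[OF q(1)] by simp
    qed
    ultimately have "matrix_cong \<qq> (L (- (2 * c\<^sup>2 * x))) (B ** T (- (x + x)))"
      using matrix_cong_trans[OF q(1)] matrix_cong_sym[OF q(1)] by blast
    then have "L (- (2 * c\<^sup>2 * x)) \<in> core H"
      by (intro matrix_cong_mem[OF q(1) subgroup_core[OF H]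
            principal_congruence_subgroup_core[OF H q(1) level_congruence_subset] _ core]) simp_all
    then show ?thesis
      using T_in_core_if_L[OF H] T_in_core_iff[OF H] by force
  qed
  have "r * (4 * x) \<in> quasi_level H" for r
  proof -
    \<comment> \<open>Polarization again, now for every \<open>r\<close>, because \<open>c\<close>
      above is subject to no unit condition.\<close>
    have "2 * (r + 1)\<^sup>2 * x - 2 * r\<^sup>2 * x - 2 * 1\<^sup>2 * x \<in> quasi_level H"
      by (intro quasi_level_diff[OF H] sq)
    also have "2 * (r + 1)\<^sup>2 * x - 2 * r\<^sup>2 * x - 2 * 1\<^sup>2 * x = r * (4 * x)"
      by (simp add: power2_eq_square algebra_simps)
    finally show ?thesis .
  qed
  then show ?thesis
    using in_q_if_multiples four_cancel by blast
qed

end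

lemma (in congruence_level) odd_if_condition_L:
  assumes "condition_L \<qq>"
  shows "\<exists>h. 2 * h - 1 \<in> \<qq>"
proof -
  have "Idl\<^bsub>\<D>\<^esub> {2} \<subseteq> range ((*) (2 :: 'a))"
    unfolding genideal_def using ideal_principal[of "2 :: 'a"] range_eqI[of "2 :: 'a" "(*) 2" 1] by auto
  moreover have "1 \<in> \<qq> <+>\<^bsub>\<D>\<^esub> Idl\<^bsub>\<D>\<^esub> {2}"
    using assms by (simp add: condition_L_def)
  ultimately obtain y h where "y \<in> \<qq>" "1 = y + 2 * h"
    by (auto simp: set_add_def')
  then have "2 * h - 1 = - y"
    by (simp add: algebra_simps)
  then show ?thesis
    using ideal_minus[OF q(1) \<open>y \<in> \<qq>\<close>] by metis
qed

text \<open>Compare exponents at a prime \<open>P\<close> of exponent \<open>n\<close> in the level.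
  Multiplication by the radical carries \<open>x\<close> into \<open>\<qq>\<close>, so
  \<open>x\<close> has exponent at least \<open>n - 1\<close>, and \<open>2 * (n - 1)\<close> is at
  least \<open>n\<close> once \<open>n\<close> is at least 2. For \<open>n = 1\<close>, Condition L
  excludes a residue field with three elements and \<open>x\<close> lies in \<open>P\<close>. In
  both cases \<open>x * x\<close> reaches exponent \<open>n\<close>.\<close>

lemma (in congruence_level) quasi_level_eq_level:
  assumes L: "condition_L \<qq>"
  shows "quasi_level H = \<qq>"
proof
  interpret odd_congruence_level ty H \<qq>
    by unfold_locales (rule odd_if_condition_L[OF L])
  show "quasi_level H \<subseteq> \<qq>"
  proof
    fix x assume x: "x \<in> quasi_level H"
    show "x \<in> \<qq>"
    proof (cases "x = 0")
      case False
      let ?I = "range ((*) x)"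
      note I = ideal_principal[of x]
      have xI: "x \<in> ?I"
        by (rule range_eqI[of _ _ 1]) simp
      then have I0: "?I \<noteq> {0}"
        using False by auto
      have I_sub: "?I \<subseteq> J" if "ideal J \<D>" "x \<in> J" for J
        using that ideal_mult_right by auto
      \<comment> \<open>The product of \<open>R\<close> takes each prime factor of
        \<open>\<qq>\<close> once, so it is the radical.\<close>
      define R where "R = mset_set (set_mset (factors \<qq>))"
      have R: "set_mset R \<subseteq> primes"
        using prime_factorsD(1) by (auto simp: R_def)
      have "ideal_prod \<D> ?I (iprod R) \<subseteq> \<qq>"
      proof (rule ideal_prod_leI[OF q(1)])
        fix u s assume "u \<in> ?I" and s: "s \<in> iprod R"
        then obtain r where r: "u = x * r"
          by auto
        have "s \<in> P" if "P \<in># factors \<qq>" for P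
        proof -
          have P: "P \<in> primes" "P \<in># R"
            using that prime_factorsD(1) by (auto simp: R_def)
          then have "iprod R \<subseteq> P"
            using iprod_subset_iff[OF R, of "{#P#}"] ideal_prod_UNIV[OF primesD(2)[OF P(1)]] by simp
          then show ?thesis
            using s by blast
        qed
        then have "s * x \<in> \<qq>"
          using radical_mult_quasi_level x by blast
        then have "s * x * r \<in> \<qq>"
          by (rule ideal_mult_right[OF q(1)])
        then show "u * s \<in> \<qq>"
          by (simp add: r ac_simps)
      qed
      then have "factors \<qq> \<subseteq># factors ?I + R"
        using factors_subset_iff[OF ideal_ideal_prod[OF I ideal_iprod_primes[OF R]] _ q]
          ideal_prod_eq_0[OF I ideal_iprod_primes[OF R]] I0 iprod_nonzero[OF R]
          factors_ideal_prod[OF I I0 ideal_iprod_primes[OF R] iprod_nonzero[OF R]] factors_iprod[OF R]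
        by auto
      then have le: "count (factors \<qq>) P \<le> count (factors ?I) P + count R P" for P
        using mset_subset_eq_count by fastforce
      have "count (factors \<qq>) P \<le> count (factors ?I) P + count (factors ?I) P" for P
      proof (cases "P \<in># factors \<qq>")
        case True
        have R1: "count R P = 1"
          using True by (simp add: R_def)
        show ?thesis
        proof (cases "count (factors \<qq>) P = 1")
          case one: True
          have "primeideal P \<D>"
            using primesD(1)[OF prime_factorsD(1)[OF True]] .
          then have "card (carrier (\<D> Quot P)) \<noteq> 3"
            using L one prime_ideal_ord_eq[OF q, of P] by (auto simp: condition_L_def)
          then have "x \<in> P"
            using quasi_level_subset_prime[OF True one _ x] by blast
          then have "P \<in># factors ?I"
            using in_factors_iff[OF I I0] prime_factorsD(1)[OF True] I_sub primesD(2) by blast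
          then have "count (factors ?I) P \<ge> 1"
            by simp
          then show ?thesis
            using one by linarith
        next
          case False
          moreover have "count (factors \<qq>) P \<ge> 1"
            using True by simp
          ultimately show ?thesis
            using le[of P] R1 by linarith
        qed
      qed (simp add: not_in_iff)
      then have "factors \<qq> \<subseteq># factors (ideal_prod \<D> ?I ?I)"
        using factors_ideal_prod[OF I I0 I I0] by (simp add: subseteq_mset_def)
      then have "ideal_prod \<D> ?I ?I \<subseteq> \<qq>"
        using factors_subset_iff[OF ideal_ideal_prod[OF I I] _ q] ideal_prod_eq_0[OF I I] I0 by blast
      then have "x * x \<in> \<qq>"
        using ideal_prod_mem[OF xI xI] by blast
      then show ?thesis
        by (rule square_zero_in_q[OF x])
    qed (simp add: ideal_0[OF q(1)])
  qed
  show "\<qq> \<subseteq> quasi_level H"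
    by (rule q_le_quasi_level)
qed

text \<open>The quasi-amplitudes of a normal subgroup all coincide with the quasi-level, which is
  the level and thus a cusp amplitude.\<close>

lemma (in congruence_level) quasi_amplitudes_normal:
  assumes L: "condition_L \<qq>" and normal: "H \<lhd> SL2"
  shows "quasi_amplitudes H \<subseteq> cusp_amplitudes H"
proof -
  have "quasi_amplitude H g = \<qq>" if "g \<in> carrier SL2" for g
  proof -
    have "quasi_amplitude H g = quasi_level H"
      using quasi_amplitude_normal[OF normal] that by (auto simp: quasi_level_def)
    then show ?thesis
      using quasi_level_eq_level[OF L] by simp
  qed
  then show ?thesis
    using Inter_cusp_amplitudes(2) by (auto simp: quasi_amplitudes_def)
qed

theorem theoremD:
  fixes \<qq> :: "'a::idom set" and H :: "('a ^ 2 ^ 2) set"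
  assumes "dedekind_domain TYPE('a)"
    and "ideal \<qq> \<D>" and "\<qq> \<noteq> {0}"
    and "subgroup H SL2" and "level H = \<qq>"
    and "congruence_subgroup H"
  shows "principal_congruence_subgroup \<qq> \<subseteq> H \<and>
    Idl\<^bsub>\<D>\<^esub> (\<Union>(cusp_amplitudes H)) \<in> cusp_amplitudes H \<and>
    \<Inter>(cusp_amplitudes H) \<in> cusp_amplitudes H \<and>
    \<qq> \<in> cusp_amplitudes H \<and>
    (\<forall>\<alpha>. (\<exists>\<beta>. \<alpha> * \<beta> - 1 \<in> \<qq>) \<longrightarrow> (\<lambda>x. \<alpha>\<^sup>2 * x) ` quasi_level H \<subseteq> quasi_level H) \<and>
    (condition_L \<qq> \<longrightarrow>
       quasi_level H = level H \<and>
       (finite (rcosets\<^bsub>SL2\<^esub> H) \<longrightarrow>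
          card (carrier (\<D> Quot level H)) dvd fact (card (rcosets\<^bsub>SL2\<^esub> H)))) \<and>
    (condition_L \<qq> \<and> H \<lhd> SL2 \<longrightarrow>
       quasi_amplitudes H \<subseteq> cusp_amplitudes H \<and>
       (finite (rcosets\<^bsub>SL2\<^esub> H) \<longrightarrow>
          card (carrier (\<D> Quot level H)) dvd card (rcosets\<^bsub>SL2\<^esub> H)))"
proof -
  interpret congruence_level "TYPE('a)" H \<qq>
    by (intro congruence_level.intro congruence_level_axioms.intro dedekind.intro assms)
  note ql = quasi_level_eq_level
  have "card (carrier (\<D> Quot level H)) dvd fact (card (rcosets\<^bsub>SL2\<^esub> H))"
    if "condition_L \<qq>" "finite (rcosets\<^bsub>SL2\<^esub> H)"
    using card_Quot_dvd_fact[OF H that(2)] q(1) by (simp add: ql[OF that(1)] level)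
  moreover have "card (carrier (\<D> Quot level H)) dvd card (rcosets\<^bsub>SL2\<^esub> H)"
    if "condition_L \<qq>" "H \<lhd> SL2"
    using card_Quot_dvd_index[OF that(2)] q(1) by (simp add: ql[OF that(1)] level)
  moreover have "\<Inter>(cusp_amplitudes H) \<in> cusp_amplitudes H"
    using Inter_cusp_amplitudes by simp
  ultimately show ?thesis
    using level_congruence_subset Idl_cusp_amplitudes Inter_cusp_amplitudes(2) square_mult_quasi_level
      ql level quasi_amplitudes_normal by auto
qed

end
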